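(* For every nonempty set $P$ of prime numbers, the complete theory $T_P$ of the structure $\mathcal{Z}_P$, regarded as an $L_P^E$-theory via the natural interpretation of the additional symbols, eliminates quantifiers in the language $L_P^E$.
   Context: For a prime $p$, $v_p:\mathbb{Z}\to\mathbb{N}\cup\{\infty\}$ is the $p$-adic valuation, $v_p(a)=\sup\{k\in\mathbb{N}: p^k\mid a\}$, and $a\,|_p\,b$ means $v_p(a)\le v_p(b)$. For a nonempty set $P$ of primes, $L_P=\{+,0\}\cup\{|_p : p\in P\}$ (each $|_p$ a binary relation symbol), $\mathcal{Z}_P$ is the $L_P$-structure $(\mathbb{Z},+,0,(|_p)_{p\in P})$ with the interpretations above, and $T_P=\mathrm{Th}(\mathcal{Z}_P)$. The language $L_P^E=L_P\cup\{-,1\}\cup\{D_n : n\ge 1\}$, where $-$ and $1$ are interpreted as usual in $\mathbb{Z}$ and each $D_n$ is a unary predicate interpreted as $n\mathbb{Z}=\{na: a\in\mathbb{Z}\}$ (all of these are $\emptyset$-definable in $\mathcal{Z}_P$). *)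

theory Defs
  imports "HOL-Library.Extended_Nat" "HOL-Computational_Algebra.Primes"
begin

section \<open>First-order logic with equality\<close>

datatype 'f trm = Var nat | Fun 'f "'f trm list"

datatype ('f, 'r) fm =
    Eq "'f trm" "'f trm"
  | Rel 'r "'f trm list"
  | Neg "('f, 'r) fm"
  | And "('f, 'r) fm" "('f, 'r) fm"
  | Exists nat "('f, 'r) fm"

definition Or :: "('f, 'r) fm \<Rightarrow> ('f, 'r) fm \<Rightarrow> ('f, 'r) fm" where
  "Or \<phi> \<psi> = Neg (And (Neg \<phi>) (Neg \<psi>))"

definition Imp :: "('f, 'r) fm \<Rightarrow> ('f, 'r) fm \<Rightarrow> ('f, 'r) fm" where
  "Imp \<phi> \<psi> = Or (Neg \<phi>) \<psi>"

definition Iff :: "('f, 'r) fm \<Rightarrow> ('f, 'r) fm \<Rightarrow> ('f, 'r) fm" where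
  "Iff \<phi> \<psi> = And (Imp \<phi> \<psi>) (Imp \<psi> \<phi>)"

definition Forall :: "nat \<Rightarrow> ('f, 'r) fm \<Rightarrow> ('f, 'r) fm" where
  "Forall x \<phi> = Neg (Exists x (Neg \<phi>))"

primrec fvt :: "'f trm \<Rightarrow> nat set" where
  "fvt (Var x) = {x}"
| "fvt (Fun f ts) = \<Union> (set (map fvt ts))"

primrec fv :: "('f, 'r) fm \<Rightarrow> nat set" where
  "fv (Eq s t) = fvt s \<union> fvt t"
| "fv (Rel r ts) = \<Union> (set (map fvt ts))"
| "fv (Neg \<phi>) = fv \<phi>"
| "fv (And \<phi> \<psi>) = fv \<phi> \<union> fv \<psi>"
| "fv (Exists x \<phi>) = fv \<phi> - {x}"

primrec quantifier_free :: "('f, 'r) fm \<Rightarrow> bool" where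
  "quantifier_free (Eq s t) \<longleftrightarrow> True"
| "quantifier_free (Rel r ts) \<longleftrightarrow> True"
| "quantifier_free (Neg \<phi>) \<longleftrightarrow> quantifier_free \<phi>"
| "quantifier_free (And \<phi> \<psi>) \<longleftrightarrow> quantifier_free \<phi> \<and> quantifier_free \<psi>"
| "quantifier_free (Exists x \<phi>) \<longleftrightarrow> False"

text \<open>A language is a set of function symbols and a set of relation symbols, each symbol
  paired with its arity; constants are function symbols of arity 0.\<close>

record ('f, 'r) language =
  funs :: "('f \<times> nat) set"
  rels :: "('r \<times> nat) set"

primrec wf_trm :: "('f, 'r) language \<Rightarrow> 'f trm \<Rightarrow> bool" where
  "wf_trm L (Var x) \<longleftrightarrow> True"
| "wf_trm L (Fun f ts) \<longleftrightarrow> (f, length ts) \<in> funs L \<and> list_all id (map (wf_trm L) ts)"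

primrec wf_fm :: "('f, 'r) language \<Rightarrow> ('f, 'r) fm \<Rightarrow> bool" where
  "wf_fm L (Eq s t) \<longleftrightarrow> wf_trm L s \<and> wf_trm L t"
| "wf_fm L (Rel r ts) \<longleftrightarrow> (r, length ts) \<in> rels L \<and> (\<forall>t\<in>set ts. wf_trm L t)"
| "wf_fm L (Neg \<phi>) \<longleftrightarrow> wf_fm L \<phi>"
| "wf_fm L (And \<phi> \<psi>) \<longleftrightarrow> wf_fm L \<phi> \<and> wf_fm L \<psi>"
| "wf_fm L (Exists x \<phi>) \<longleftrightarrow> wf_fm L \<phi>"

definition sentence :: "('f, 'r) language \<Rightarrow> ('f, 'r) fm \<Rightarrow> bool" where
  "sentence L \<sigma> \<longleftrightarrow> wf_fm L \<sigma> \<and> fv \<sigma> = {}"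

record ('f, 'r, 'm) struct =
  univ :: "'m set"
  fint :: "'f \<Rightarrow> 'm list \<Rightarrow> 'm"
  rint :: "'r \<Rightarrow> 'm list \<Rightarrow> bool"

text \<open>Interpretations of symbols outside \<open>L\<close>, at a wrong arity, or outside the domain are
  irrelevant, so the same record may serve as a structure for several languages.\<close>

definition is_structure :: "('f, 'r) language \<Rightarrow> ('f, 'r, 'm) struct \<Rightarrow> bool" where
  "is_structure L M \<longleftrightarrow> univ M \<noteq> {} \<and>
     (\<forall>(f, n)\<in>funs L. \<forall>as. length as = n \<and> set as \<subseteq> univ M \<longrightarrow> fint M f as \<in> univ M)"

primrec eval :: "('f, 'r, 'm) struct \<Rightarrow> (nat \<Rightarrow> 'm) \<Rightarrow> 'f trm \<Rightarrow> 'm" where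
  "eval M e (Var x) = e x"
| "eval M e (Fun f ts) = fint M f (map (eval M e) ts)"

primrec sat :: "('f, 'r, 'm) struct \<Rightarrow> (nat \<Rightarrow> 'm) \<Rightarrow> ('f, 'r) fm \<Rightarrow> bool" where
  "sat M e (Eq s t) \<longleftrightarrow> eval M e s = eval M e t"
| "sat M e (Rel r ts) \<longleftrightarrow> rint M r (map (eval M e) ts)"
| "sat M e (Neg \<phi>) \<longleftrightarrow> \<not> sat M e \<phi>"
| "sat M e (And \<phi> \<psi>) \<longleftrightarrow> sat M e \<phi> \<and> sat M e \<psi>"
| "sat M e (Exists x \<phi>) \<longleftrightarrow> (\<exists>a\<in>univ M. sat M (e(x := a)) \<phi>)"

text \<open>Validity of the universal closure.\<close>

definition valid :: "('f, 'r, 'm) struct \<Rightarrow> ('f, 'r) fm \<Rightarrow> bool" where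
  "valid M \<phi> \<longleftrightarrow> (\<forall>e. range e \<subseteq> univ M \<longrightarrow> sat M e \<phi>)"

definition Th :: "('f, 'r) language \<Rightarrow> ('f, 'r, 'm) struct \<Rightarrow> ('f, 'r) fm set" where
  "Th L M = {\<sigma>. sentence L \<sigma> \<and> valid M \<sigma>}"

definition is_model ::
    "('f, 'r) language \<Rightarrow> ('f, 'r, 'm) struct \<Rightarrow> ('f, 'r) fm set \<Rightarrow> bool" where
  "is_model L M T \<longleftrightarrow> is_structure L M \<and> (\<forall>\<sigma>\<in>T. valid M \<sigma>)"

text \<open>Semantic consequence, ranging over the models whose domain is a set of elements of \<open>'m\<close>:
  HOL cannot quantify over types inside a formula, so \<open>'m\<close> is an explicit parameter.  For a theory
  of the form \<open>Th L N\<close> this parameter is harmless, see \<open>entails_Th\<close> below.\<close>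

definition entails ::
    "'m itself \<Rightarrow> ('f, 'r) language \<Rightarrow> ('f, 'r) fm set \<Rightarrow> ('f, 'r) fm \<Rightarrow> bool" where
  "entails (_ :: 'm itself) L T \<phi> \<longleftrightarrow>
     (\<forall>M :: ('f, 'r, 'm) struct. is_model L M T \<longrightarrow> valid M \<phi>)"

definition eliminates_quantifiers ::
    "'m itself \<Rightarrow> ('f, 'r) language \<Rightarrow> ('f, 'r) fm set \<Rightarrow> bool" where
  "eliminates_quantifiers (Ty :: 'm itself) L T \<longleftrightarrow>
     (\<forall>\<phi>. wf_fm L \<phi> \<longrightarrow>
        (\<exists>\<psi>. wf_fm L \<psi> \<and> quantifier_free \<psi> \<and> fv \<psi> \<subseteq> fv \<phi> \<and> entails Ty L T (Iff \<phi> \<psi>)))"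


section \<open>The structure of the integers with the divisibility relations\<close>

text \<open>In contrast to \<^const>\<open>multiplicity\<close>, the value at 0 is \<open>\<infinity>\<close>.\<close>

definition vp :: "nat \<Rightarrow> int \<Rightarrow> enat" where
  "vp p a = Sup (enat ` {k. int p ^ k dvd a})"

datatype fsym = Plus | Zero | Minus | One

datatype rsym = VDvd nat | D nat

text \<open>\<open>Minus\<close> is the unary additive inverse.\<close>

definition lang :: "nat set \<Rightarrow> (fsym, rsym) language" where
  "lang P = \<lparr>funs = {(Plus, 2), (Zero, 0)}, rels = {(VDvd p, 2) | p. p \<in> P}\<rparr>"

definition langE :: "nat set \<Rightarrow> (fsym, rsym) language" where
  "langE P = \<lparr>funs = funs (lang P) \<union> {(Minus, 1), (One, 0)},
              rels = rels (lang P) \<union> {(D n, 1) | n. n \<ge> 1}\<rparr>"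

fun fun_int :: "fsym \<Rightarrow> int list \<Rightarrow> int" where
  "fun_int Plus [a, b] = a + b"
| "fun_int Zero [] = 0"
| "fun_int Minus [a] = - a"
| "fun_int One [] = 1"
| "fun_int _ _ = 0"

fun rel_int :: "rsym \<Rightarrow> int list \<Rightarrow> bool" where
  "rel_int (VDvd p) [a, b] \<longleftrightarrow> vp p a \<le> vp p b"
| "rel_int (D n) [a] \<longleftrightarrow> a \<in> {int n * b | b. True}"
| "rel_int _ _ \<longleftrightarrow> False"

definition ZZ :: "(fsym, rsym, int) struct" where
  "ZZ = \<lparr>univ = UNIV, fint = fun_int, rint = rel_int\<rparr>"

definition TP :: "nat set \<Rightarrow> (fsym, rsym) fm set" where
  "TP P = Th (lang P) ZZ"

text \<open>\<open>TP P\<close> regarded as a theory in the larger language.  This is the theory of the expanded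
  structure and not a definitional expansion of \<open>TP P\<close>: negation is an automorphism of
  the integers with \<open>+\<close>, \<open>0\<close> and the valuation relations, so 1 is definable in them
  only up to sign.\<close>

definition TPE :: "nat set \<Rightarrow> (fsym, rsym) fm set" where
  "TPE P = Th (langE P) ZZ"


section \<open>Consistency of the definitions\<close>

lemma vp_0: "vp p 0 = \<infinity>"
proof (rule ccontr)
  assume "vp p 0 \<noteq> \<infinity>"
  then obtain n where n: "vp p 0 = enat n" by auto
  have "enat (Suc n) \<le> vp p 0"
    unfolding vp_def by (rule Sup_upper) simp
  then show False using n by simp
qed

lemma vp_nonzero:
  assumes "prime p" "a \<noteq> 0"
  shows "vp p a = enat (multiplicity (int p) a)"
proof -
  have "int p ^ k dvd a \<longleftrightarrow> k \<le> multiplicity (int p) a" for k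
    using assms by (intro power_dvd_iff_le_multiplicity) (auto dest: not_prime_unit)
  then have "vp p a = Sup (enat ` {.. multiplicity (int p) a})"
    by (simp add: vp_def atMost_def)
  also have "\<dots> = enat (multiplicity (int p) a)"
    by (intro antisym Sup_least Sup_upper) auto
  finally show ?thesis .
qed

lemma is_structure_ZZ: "is_structure (lang P) ZZ" "is_structure (langE P) ZZ"
  by (simp_all add: is_structure_def ZZ_def)

lemma wf_trm_mono: "wf_trm (lang P) t \<Longrightarrow> wf_trm (langE P) t"
  by (induction t) (auto simp: langE_def list_all_iff)

lemma wf_fm_mono: "wf_fm (lang P) \<phi> \<Longrightarrow> wf_fm (langE P) \<phi>"
proof (induction \<phi>)
  case (Rel r ts)
  then show ?case using wf_trm_mono by (auto simp: langE_def)
qed (auto intro: wf_trm_mono)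

lemma TP_eq: "TP P = {\<sigma> \<in> TPE P. wf_fm (lang P) \<sigma>}"
  by (auto simp: TP_def TPE_def Th_def sentence_def wf_fm_mono)

lemma valid_Forall:
  fixes M :: "('f, 'r, 'a) struct"
  shows "valid M (Forall x \<phi>) \<longleftrightarrow> valid M \<phi>"
proof
  assume *: "valid M (Forall x \<phi>)"
  show "valid M \<phi>" unfolding valid_def
  proof (intro allI impI)
    fix e :: "nat \<Rightarrow> 'a" assume e: "range e \<subseteq> univ M"
    then have "sat M e (Forall x \<phi>)" using * unfolding valid_def by blast
    then have "\<forall>a\<in>univ M. sat M (e(x := a)) \<phi>" by (simp add: Forall_def)
    moreover have "e x \<in> univ M" using e by auto
    ultimately have "sat M (e(x := e x)) \<phi>" by blast
    then show "sat M e \<phi>" by simp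
  qed
next
  assume *: "valid M \<phi>"
  show "valid M (Forall x \<phi>)" unfolding valid_def
  proof (intro allI impI)
    fix e :: "nat \<Rightarrow> 'a" assume e: "range e \<subseteq> univ M"
    have "sat M (e(x := a)) \<phi>" if "a \<in> univ M" for a
    proof -
      have "range (e(x := a)) \<subseteq> univ M" using e that by auto
      then show ?thesis using * unfolding valid_def by blast
    qed
    then show "sat M e (Forall x \<phi>)" by (simp add: Forall_def)
  qed
qed

lemma finite_fvt: "finite (fvt t)"
  by (induction t) auto

lemma finite_fv: "finite (fv \<phi>)"
  by (induction \<phi>) (auto simp: finite_fvt)

text \<open>What is valid in \<open>N\<close> follows from \<open>Th L N\<close> over models of every type, and conversely if
  \<open>N\<close> itself is among the models considered.  Hence for the theory of the integers, the
  instance \<open>'m = int\<close> of quantifier elimination yields quantifier-free equivalents that do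
  not depend on \<open>'m\<close>.\<close>

lemma entails_Th:
  fixes N :: "('f, 'r, 'n) struct"
  assumes "is_structure L N" "wf_fm L \<phi>"
  shows "entails TYPE('n) L (Th L N) \<phi> \<longleftrightarrow> valid N \<phi>"
    and "valid N \<phi> \<Longrightarrow> entails TYPE('m) L (Th L N) \<phi>"
proof -
  obtain xs where xs: "set xs = fv \<phi>" using finite_list[OF finite_fv] by blast
  define \<sigma> where "\<sigma> = foldr Forall xs \<phi>"
  have fv: "fv (foldr Forall ys \<phi>) = fv \<phi> - set ys" for ys
    by (induction ys) (auto simp: Forall_def)
  have wf: "wf_fm L (foldr Forall ys \<phi>)" for ys
    using assms by (induction ys) (auto simp: Forall_def)
  have val': "valid M (foldr Forall ys \<phi>) \<longleftrightarrow> valid M \<phi>" for M :: "('f, 'r, 'n) struct" and ys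
    by (induction ys) (auto simp: valid_Forall)
  have val'': "valid M (foldr Forall ys \<phi>) \<longleftrightarrow> valid M \<phi>" for M :: "('f, 'r, 'm) struct" and ys
    by (induction ys) (auto simp: valid_Forall)
  have in_Th: "\<sigma> \<in> Th L N" if "valid N \<phi>"
    using that xs by (simp add: Th_def sentence_def \<sigma>_def fv wf val')
  show "valid N \<phi> \<Longrightarrow> entails TYPE('m) L (Th L N) \<phi>"
    unfolding entails_def is_model_def using in_Th val'' unfolding \<sigma>_def by blast
  have "is_model L N (Th L N)" using assms by (simp add: is_model_def Th_def)
  then have "entails TYPE('n) L (Th L N) \<phi> \<Longrightarrow> valid N \<phi>"
    unfolding entails_def by blast
  moreover have "valid N \<phi> \<Longrightarrow> entails TYPE('n) L (Th L N) \<phi>"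
    unfolding entails_def is_model_def using in_Th val' unfolding \<sigma>_def by blast
  ultimately show "entails TYPE('n) L (Th L N) \<phi> \<longleftrightarrow> valid N \<phi>" by blast
qed

end

theory Submission
  imports Defs
begin

text \<open>By \<open>entails_Th\<close> it suffices to eliminate a quantifier over the integers. Up to finitely many
  cases, \<open>\<exists>a\<close> is applied to a prescription of the truth values of finitely many atoms in affine
  forms \<open>c * a + l\<close>. If \<open>a\<close> is a root of one of the forms, it can be substituted. If it is not, the
  residue of \<open>a\<close> modulo all moduli decides the atoms \<open>D n\<close>, and the valuation atoms for the different primes
  are independent of each other, by the Chinese remainder theorem and because they are open conditions.

  For one prime \<open>p\<close>, let \<open>A\<close> be the product of the nonzero coefficients, so that up to a constant
  factor the forms at \<open>a\<close> become \<open>z - T i\<close> with \<open>z = A * a\<close>. Let \<open>\<gamma>\<close> be the valuation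
  of \<open>z - T i\<close> for the centre \<open>T i\<close> nearest to \<open>z\<close>. Comparisons of valuations only change when
  \<open>\<gamma>\<close> crosses a value \<open>v(u) + k\<close>, with \<open>k\<close> bounded and \<open>u\<close> a constant or a difference
  of centres. Hence if there is a solution, then there is one among the finitely many \<open>p\<close>-adic
  test points \<open>z = T i + r * p^k * u\<close> with \<open>0 < r < p\<close>, and substituting these eliminates \<open>a\<close>.\<close>

section \<open>Valuations\<close>

text \<open>\<open>multiplicity\<close> is 0 at 0, where \<open>vp\<close> is \<infinity>, so zero
  arguments have to be separated before valuations can be treated as natural numbers.\<close>

lemma vp_le_iff:
  assumes "prime p"
  shows "vp p a \<le> vp p b \<longleftrightarrow>
    b = 0 \<or> a \<noteq> 0 \<and> multiplicity (int p) a \<le> multiplicity (int p) b"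
  using assms by (cases "a = 0"; cases "b = 0") (auto simp: vp_0 vp_nonzero)

text \<open>The valuation is locally constant away from 0: a perturbation by a multiple of
  \<open>q ^ M\<close> cannot reach the leading digit of \<open>s'\<close>, which sits at a place
  below \<open>M\<close>. This is what makes valuation conditions open.\<close>

lemma multiplicity_approx:
  fixes q s s' :: int
  assumes "prime q" and "q ^ M dvd s - s'" and "s' \<noteq> 0" and "multiplicity q s' < M"
  shows "s \<noteq> 0 \<and> multiplicity q s = multiplicity q s'"
proof -
  let ?n = "multiplicity q s'"
  have nu: "\<not> is_unit q" using assms(1) by (auto dest: not_prime_unit)
  have d: "q ^ ?n dvd s - s'" "q ^ Suc ?n dvd s - s'"
    using assms(2,4) by (auto intro: power_le_dvd simp del: power_Suc)
  have "q ^ ?n dvd s'" by (rule multiplicity_dvd)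
  then have 1: "q ^ ?n dvd s" using dvd_add[OF d(1), of s'] by simp
  have "\<not> q ^ Suc ?n dvd s'"
    using nu assms(3) by (simp add: power_dvd_iff_le_multiplicity del: power_Suc)
  then have 2: "\<not> q ^ Suc ?n dvd s" using dvd_diff[OF _ d(2), of s] by auto
  show ?thesis using 1 2 multiplicity_eqI by (metis dvd_0_right)
qed

text \<open>\<open>u\<close> is invertible modulo \<open>q\<close>, and \<open>r\<close> is the
  residue of \<open>y / u\<close>. It will serve as the leading digit of a test point.\<close>

lemma unit_ratio_mod_prime:
  fixes q u y :: int
  assumes "prime q" and "\<not> q dvd u" and "\<not> q dvd y"
  obtains r where "0 < r" and "r < q" and "q dvd r * u - y"
proof -
  have "coprime u q"
    using assms by (metis coprime_commute prime_imp_coprime)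
  then obtain w k where w: "w * u + k * q = 1"
    by (metis bezout_int coprime_imp_gcd_eq_1)
  define r where "r = (y * w) mod q"
  have q0: "q > 0" using assms(1) by (rule prime_gt_0_int)
  have "q dvd r - y * w" by (simp add: r_def mod_eq_dvd_iff flip: mod_eq_dvd_iff)
  then have "q dvd (r - y * w) * u" by simp
  moreover have "(r - y * w) * u = (r * u - y) + q * (y * k)"
  proof -
    have "y * (w * u) = y * (1 - k * q)" using w by (metis add_diff_cancel_right')
    then show ?thesis by (simp add: algebra_simps)
  qed
  ultimately have dv: "q dvd r * u - y" by (metis dvd_add_left_iff dvd_triv_left)
  have "r \<noteq> 0" using dv assms(3) by auto
  then have "0 < r" "r < q"
    using q0 pos_mod_bound[of q "y * w"] pos_mod_sign[of q "y * w"] unfolding r_def by linarith+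
  with dv show ?thesis using that by blast
qed

text \<open>The valuation of \<open>z - T i\<close>, for the centre \<open>T i\<close> nearest to \<open>z\<close>, is lowered to the next
  threshold, i.e. to the next number that is within \<open>K\<close> of some \<open>multiplicity q u\<close>.\<close>

lemma nearest_centre_descent:
  fixes q z :: int and T :: "'i \<Rightarrow> int" and K :: nat
  assumes q: "prime q" and I: "finite I" "I \<noteq> {}" and zT: "\<And>i. i \<in> I \<Longrightarrow> z \<noteq> T i"
    and U: "finite U" and K: "K \<ge> 1"
  obtains i u r E z' \<gamma>' \<gamma> where
    "i \<in> I" and "u \<in> insert 1 (U \<union> (\<lambda>j. T i - T j) ` I)" and "0 < r" and "r < q" and "E \<le> 2 * K"
    and "q ^ K * (z' - T i) = r * q ^ E * u"
    and "\<forall>j\<in>I. z' \<noteq> T j"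
    and "(\<forall>j\<in>I. multiplicity q (z' - T j) = multiplicity q (z - T j)) \<or>
      \<gamma>' < \<gamma> \<and>
      (\<forall>j\<in>I. T i \<noteq> T j \<and> multiplicity q (z' - T j) = multiplicity q (T i - T j) \<and>
              multiplicity q (z - T j) = multiplicity q (T i - T j) \<or>
            multiplicity q (z' - T j) = \<gamma>' \<and> multiplicity q (z - T j) = \<gamma>) \<and>
      (\<forall>u \<in> insert 1 (U \<union> (\<lambda>j. T i - T j) ` I). \<forall>n. u \<noteq> 0 \<longrightarrow> \<gamma>' < n \<longrightarrow> n \<le> \<gamma> \<longrightarrow>
            n > multiplicity q u + K \<or> multiplicity q u > n + K)"
proof -
  let ?m = "multiplicity q"
  have nu: "\<not> is_unit q" using q by (auto dest: not_prime_unit)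
  have q0: "q > 0" using q by (rule prime_gt_0_int)
  define \<gamma> where "\<gamma> = Max ((\<lambda>i. ?m (z - T i)) ` I)"
  have "\<gamma> \<in> (\<lambda>i. ?m (z - T i)) ` I" unfolding \<gamma>_def using I by (intro Max_in) auto
  then obtain i where i: "i \<in> I" "?m (z - T i) = \<gamma>" by auto
  have max: "?m (z - T j) \<le> \<gamma>" if "j \<in> I" for j
    unfolding \<gamma>_def using I that by (intro Max_ge) auto
  define U' where "U' = insert 1 (U \<union> (\<lambda>j. T i - T j) ` I)"
  \<comment> \<open>The thresholds not above \<open>\<gamma>\<close>. The element 1, of valuation 0,
    puts 0 among them, so there is a largest one.\<close>
  define \<Theta> where "\<Theta> = {n. n \<le> \<gamma> \<and> (\<exists>u\<in>U'. u \<noteq> 0 \<and> n \<le> ?m u + K \<and> ?m u \<le> n + K)}"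
  have fin: "finite \<Theta>" unfolding \<Theta>_def by (rule finite_subset[of _ "{..\<gamma>}"]) auto
  have "0 \<in> \<Theta>" by (auto simp: \<Theta>_def U'_def intro!: bexI[of _ 1])
  define \<gamma>' where "\<gamma>' = Max \<Theta>"
  have "\<gamma>' \<in> \<Theta>" unfolding \<gamma>'_def using fin \<open>0 \<in> \<Theta>\<close> by (intro Max_in) auto
  then obtain u where u: "u \<in> U'" "u \<noteq> 0" "\<gamma>' \<le> ?m u + K" "?m u \<le> \<gamma>' + K" and le: "\<gamma>' \<le> \<gamma>"
    by (auto simp: \<Theta>_def)
  have gap: "n > ?m v + K \<or> ?m v > n + K" if "v \<in> U'" "v \<noteq> 0" "\<gamma>' < n" "n \<le> \<gamma>" for v n
  proof (rule ccontr)
    assume "\<not> ?thesis"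
    then have "n \<in> \<Theta>" using that by (auto simp: \<Theta>_def)
    then have "n \<le> \<gamma>'" unfolding \<gamma>'_def using fin by (intro Max_ge)
    then show False using that by simp
  qed
  obtain u0 where u0: "u = q ^ ?m u * u0" "\<not> q dvd u0"
    using multiplicity_decompose'[OF u(2) nu] by metis
  obtain y0 where y0: "z - T i = q ^ \<gamma> * y0" "\<not> q dvd y0"
    using multiplicity_decompose'[of "z - T i" q] zT[OF i(1)] nu i(2) by auto
  \<comment> \<open>The subtraction does not truncate, since
    \<open>multiplicity q u \<le> \<gamma>' + K\<close>; the other bound on \<open>u\<close> gives
    \<open>E \<le> 2 * K\<close>. The factor \<open>q ^ K\<close> in \<open>eq\<close> makes up for
    the possibly negative exponent \<open>\<gamma>' - multiplicity q u\<close>.\<close>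
  define E where "E = K + \<gamma>' - ?m u"
  have E: "E \<le> 2 * K" "E + ?m u = K + \<gamma>'" using u by (auto simp: E_def)
  have eq: "q ^ K * ((T i + r * q ^ \<gamma>' * u0) - T i) = r * q ^ E * u" for r
  proof -
    have "r * q ^ E * u = r * q ^ (E + ?m u) * u0"
      by (subst u0(1)) (simp add: power_add)
    also have "\<dots> = q ^ K * (r * q ^ \<gamma>' * u0)"
      by (simp add: E(2) power_add)
    finally show ?thesis by (metis add_diff_cancel_left')
  qed
  show ?thesis
  proof (cases "\<gamma>' = \<gamma>")
    case True
    \<comment> \<open>Nothing is lowered here, so the leading digit of \<open>z - T i\<close> has to
      be matched. Then \<open>z'\<close> agrees with \<open>z\<close> modulo
      \<open>q ^ Suc \<gamma>\<close>, and no \<open>z - T j\<close> has valuation above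
      \<open>\<gamma>\<close>.\<close>
    obtain r where r: "0 < r" "r < q" "q dvd r * u0 - y0"
      using unit_ratio_mod_prime[OF q u0(2) y0(2)] by blast
    define z' where "z' = T i + r * q ^ \<gamma>' * u0"
    have "z' - z = q ^ \<gamma> * (r * u0 - y0)" using y0(1) by (simp add: z'_def True algebra_simps)
    then have zz: "q ^ Suc \<gamma> dvd z' - z" using r(3) by (simp add: mult.commute mult_dvd_mono)
    have *: "z' \<noteq> T j \<and> ?m (z' - T j) = ?m (z - T j)" if "j \<in> I" for j
      using multiplicity_approx[OF q, of "Suc \<gamma>" "z' - T j" "z - T j"] zz zT[OF that] max[OF that]
      by auto
    show ?thesis
      by (rule that[of i u r E z' \<gamma>' \<gamma>]) (use i u(1) r E eq[of r] * in \<open>auto simp: U'_def z'_def\<close>)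
  next
    case False
    then have lt: "\<gamma>' < \<gamma>" using le by simp
    \<comment> \<open>The digit 1 will do, because no other centre differs from \<open>T i\<close>
      by a number of valuation exactly \<open>\<gamma>'\<close>.\<close>
    define z' where "z' = T i + 1 * q ^ \<gamma>' * u0"
    have z'i: "z' - T i = q ^ \<gamma>' * u0" by (simp add: z'_def)
    have u00: "u0 \<noteq> 0" using u0(2) by auto
    have ne: "z' - T i \<noteq> 0" using z'i u00 q0 by simp
    have mi: "?m (z' - T i) = \<gamma>'" using z'i u0(2) by (intro multiplicity_eqI) (auto simp: q0 less_imp_neq[symmetric])
    have *: "z' \<noteq> T j \<and> (T i \<noteq> T j \<and> ?m (z' - T j) = ?m (T i - T j) \<and> ?m (z - T j) = ?m (T i - T j) \<or>
            ?m (z' - T j) = \<gamma>' \<and> ?m (z - T j) = \<gamma>)" if j: "j \<in> I" for j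
    proof (cases "T i = T j")
      case True
      then show ?thesis using ne mi i by auto
    next
      case False
      let ?\<mu> = "?m (T i - T j)"
      have inU: "T i - T j \<in> U'" using j by (auto simp: U'_def)
      \<comment> \<open>If \<open>?\<mu>\<close> were \<open>\<gamma>'\<close>, then
        \<open>Suc \<gamma>'\<close> would be a threshold in the gap, as \<open>K \<ge> 1\<close>; a
        \<open>?\<mu>\<close> inside the gap would itself be one.\<close>
      have "?\<mu> \<noteq> \<gamma>'" using gap[OF inU, of "Suc \<gamma>'"] False K lt by auto
      moreover have "\<not> (\<gamma>' < ?\<mu> \<and> ?\<mu> \<le> \<gamma>)" using gap[OF inU, of ?\<mu>] False by auto
      ultimately consider "?\<mu> < \<gamma>'" | "?\<mu> > \<gamma>" by linarith
      then show ?thesis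
      proof cases
        case 1
        \<comment> \<open>\<open>T j\<close> is farther from \<open>T i\<close> than both points
          are, so the difference of the centres dominates.\<close>
        have "q ^ \<gamma>' dvd (z' - T j) - (T i - T j)" using z'i by simp
        moreover have "q ^ \<gamma>' dvd (z - T j) - (T i - T j)" using y0(1) le by (auto intro!: dvd_mult2 le_imp_power_dvd)
        ultimately show ?thesis
          using multiplicity_approx[OF q, of \<gamma>' "z' - T j" "T i - T j"]
            multiplicity_approx[OF q, of \<gamma>' "z - T j" "T i - T j"] 1 False by auto
      next
        case 2
        \<comment> \<open>\<open>T j\<close> is so close to \<open>T i\<close> that neither point
          distinguishes the two centres.\<close>
        have d: "q ^ Suc \<gamma> dvd T i - T j" using 2 by (intro multiplicity_dvd') auto
        have d': "q ^ Suc \<gamma>' dvd T i - T j" using lt by (intro power_le_dvd[OF d]) simp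
        have "z' - T j \<noteq> 0 \<and> ?m (z' - T j) = ?m (z' - T i)"
          by (rule multiplicity_approx[OF q, of "Suc \<gamma>'"]) (use d' ne mi in auto)
        moreover have "z - T j \<noteq> 0 \<and> ?m (z - T j) = ?m (z - T i)"
          by (rule multiplicity_approx[OF q, of "Suc \<gamma>"]) (use d zT[OF i(1)] i in auto)
        ultimately show ?thesis using mi i by auto
      qed
    qed
    show ?thesis
      by (rule that[of i u 1 E z' \<gamma>' \<gamma>])
         (use i u(1) E eq[of 1] * gap lt prime_gt_1_int[OF q] in \<open>auto simp: U'_def z'_def\<close>)
  qed
qed

text \<open>Multiplication by \<open>A\<close> turns a nonconstant form into
  \<open>c f * (z - T f)\<close> with \<open>z = A * a\<close>, so the descent to \<open>z'\<close>
  applies and yields the fraction \<open>num / d = z' / A\<close>. The coefficients shift valuations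
  by at most \<open>multiplicity (int p) A < K\<close>, so no comparison changes within a gap
  between thresholds.\<close>

lemma test_point:
  fixes a :: int and c t :: "'i \<Rightarrow> int" and p :: nat
  assumes p: "prime p" and F: "finite F"
    and one: "k1 \<in> F" "c k1 = 0" "t k1 = 1" and var: "k2 \<in> F" "c k2 \<noteq> 0"
    and nz: "\<And>f. f \<in> F \<Longrightarrow> c f \<noteq> 0 \<Longrightarrow> c f * a + t f \<noteq> 0"
    and A: "A = (\<Prod>f\<in>{f\<in>F. c f \<noteq> 0}. c f)"
    and K: "K = multiplicity (int p) A + 1"
    and T: "\<And>f. T f = - (A div c f) * t f"
  obtains i u r E num d where
    "i \<in> F" and "c i \<noteq> 0" and "u \<in> t ` {f\<in>F. c f = 0} \<union> (\<lambda>j. T i - T j) ` {f\<in>F. c f \<noteq> 0}"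
    and "0 < r" and "r < int p" and "E \<le> 2 * K"
    and "num = int p ^ K * T i + r * int p ^ E * u" and "d = A * int p ^ K"
    and "\<And>f. f \<in> F \<Longrightarrow> c f \<noteq> 0 \<Longrightarrow> c f * num + t f * d \<noteq> 0"
    and "\<And>f g. f \<in> F \<Longrightarrow> g \<in> F \<Longrightarrow>
      vp p (c f * num + t f * d) \<le> vp p (c g * num + t g * d) \<longleftrightarrow>
      vp p (c f * a + t f) \<le> vp p (c g * a + t g)"
proof -
  define q where "q = int p"
  have q: "prime q" using p by (simp add: q_def)
  then have pe: "prime_elem q" by (rule prime_imp_prime_elem)
  have q0: "q \<noteq> 0" using q by auto
  let ?m = "multiplicity q"
  define I where "I = {f\<in>F. c f \<noteq> 0}"
  define U where "U = t ` {f\<in>F. c f = 0}"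
  define z where "z = A * a"
  have fin: "finite I" "I \<noteq> {}" "finite U" using F var by (auto simp: I_def U_def)
  have A0: "A \<noteq> 0" using fin by (auto simp: A I_def)
  have dvA: "c f dvd A" if "f \<in> I" for f
    unfolding A using fin that by (fold I_def) (rule dvd_prodI)
  have cT: "c f * T f = - A * t f" if "f \<in> I" for f
    using dvA[OF that] by (simp add: T flip: mult.assoc)
  have cz: "c f * (z - T f) = A * (c f * a + t f)" if "f \<in> I" for f
    using cT[OF that] by (simp add: z_def algebra_simps)
  have zT: "z \<noteq> T f" if "f \<in> I" for f
    using cz[OF that] nz that A0 by (auto simp: I_def)
  have K1: "K \<ge> 1" by (simp add: K)
  obtain i u r E z' \<gamma>' \<gamma> where
    *: "i \<in> I" "u \<in> insert 1 (U \<union> (\<lambda>j. T i - T j) ` I)" "0 < r" "r < q" "E \<le> 2 * K"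
      "q ^ K * (z' - T i) = r * q ^ E * u" and z'T: "\<forall>j\<in>I. z' \<noteq> T j"
    and descent: "(\<forall>j\<in>I. ?m (z' - T j) = ?m (z - T j)) \<or>
      \<gamma>' < \<gamma> \<and>
      (\<forall>j\<in>I. T i \<noteq> T j \<and> ?m (z' - T j) = ?m (T i - T j) \<and> ?m (z - T j) = ?m (T i - T j) \<or>
            ?m (z' - T j) = \<gamma>' \<and> ?m (z - T j) = \<gamma>) \<and>
      (\<forall>u \<in> insert 1 (U \<union> (\<lambda>j. T i - T j) ` I). \<forall>n. u \<noteq> 0 \<longrightarrow> \<gamma>' < n \<longrightarrow> n \<le> \<gamma> \<longrightarrow>
            n > ?m u + K \<or> ?m u > n + K)"
    by (rule nearest_centre_descent[where q=q and T=T and K=K and I=I and U=U and z=z,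
        OF q fin(1,2) zT fin(3) K1])
  define num where "num = q ^ K * T i + r * q ^ E * u"
  define d where "d = A * q ^ K"
  have num: "num = q ^ K * z'" using *(6) by (simp add: num_def algebra_simps)
  have new: "c f * num + t f * d = q ^ K * (c f * (z' - T f))" if "f \<in> I" for f
    using cT[OF that] by (simp add: num d_def algebra_simps)
  have nz': "c f * num + t f * d \<noteq> 0" if "f \<in> I" for f
    using new[OF that] z'T that that q0 by (simp add: I_def)
  note mm = prime_elem_multiplicity_mult_distrib[OF pe]
  have mK: "?m (q ^ K) = K"
    using q0 q by (intro multiplicity_same_power) (auto dest: not_prime_unit)
  \<comment> \<open>With \<open>z\<close> in place of \<open>z'\<close>, the valuations in
    \<open>mnew\<close> and \<open>mconst\<close> would be the old ones plus the same constant
    \<open>multiplicity q A + K\<close>. Hence only the passage from \<open>z\<close> to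
    \<open>z'\<close> has to be examined.\<close>
  have mnew: "?m (c f * num + t f * d) = K + (?m (c f) + ?m (z' - T f))" if "f \<in> I" for f
    using z'T that that q0 mK
    by (simp add: new[OF that] mm I_def)
  have mold: "?m A + ?m (c f * a + t f) = ?m (c f) + ?m (z - T f)" if "f \<in> I" for f
  proof -
    have "?m (A * (c f * a + t f)) = ?m (c f * (z - T f))" using cz[OF that] by simp
    then show ?thesis using A0 nz that zT[OF that]
      by (simp add: mm I_def)
  qed
  have mconst: "?m (t f * d) = ?m A + K + ?m (t f)" if "t f \<noteq> 0" for f
    using that A0 q0 mK by (simp add: mm d_def)
  have mc: "?m (c f) \<le> ?m A" if "f \<in> I" for f
    using dvA[OF that] A0 by (intro dvd_imp_multiplicity_le)
  \<comment> \<open>A comparison that changes between \<open>\<gamma>'\<close> and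
    \<open>\<gamma>\<close> does so at some \<open>n\<close> in the gap that differs from the
    valuation of \<open>v\<close> by at most \<open>multiplicity q A + 1\<close>. The extra 1 comes
    from the first comparison and explains the choice of \<open>K\<close>.\<close>
  have cmp: "x + \<gamma>' \<le> y + ?m v \<longleftrightarrow> x + \<gamma> \<le> y + ?m v" "y + ?m v \<le> x + \<gamma>' \<longleftrightarrow> y + ?m v \<le> x + \<gamma>"
    if xy: "x \<le> ?m A" "y \<le> ?m A" "\<gamma>' < \<gamma>" and "v \<noteq> 0"
      and gap: "\<forall>n. \<gamma>' < n \<longrightarrow> n \<le> \<gamma> \<longrightarrow> n > ?m v + K \<or> ?m v > n + K" for x y v
  proof -
    have K': "K = ?m A + 1" by (simp add: K q_def)
    have g: "n > ?m v + K \<or> ?m v > n + K" if "\<gamma>' < n" "n \<le> \<gamma>" for n using gap that by blast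
    have False if "x + \<gamma>' \<le> y + ?m v" "\<not> x + \<gamma> \<le> y + ?m v"
      using g[of "y + ?m v + 1 - x"] K' xy that by linarith
    then show "x + \<gamma>' \<le> y + ?m v \<longleftrightarrow> x + \<gamma> \<le> y + ?m v" using xy(3) by fastforce
    have False if "\<not> y + ?m v \<le> x + \<gamma>'" "y + ?m v \<le> x + \<gamma>"
      using g[of "y + ?m v - x"] K' xy that by linarith
    then show "y + ?m v \<le> x + \<gamma>' \<longleftrightarrow> y + ?m v \<le> x + \<gamma>" using xy(3) by fastforce
  qed
  have II: "?m (c f) + ?m (z' - T f) \<le> ?m (c g) + ?m (z' - T g) \<longleftrightarrow>
      ?m (c f) + ?m (z - T f) \<le> ?m (c g) + ?m (z - T g)" if "f \<in> I" "g \<in> I" for f g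
    using descent
  proof
    assume "\<forall>j\<in>I. ?m (z' - T j) = ?m (z - T j)"
    then show ?thesis using that by simp
  next
    assume d: "\<gamma>' < \<gamma> \<and>
      (\<forall>j\<in>I. T i \<noteq> T j \<and> ?m (z' - T j) = ?m (T i - T j) \<and> ?m (z - T j) = ?m (T i - T j) \<or>
            ?m (z' - T j) = \<gamma>' \<and> ?m (z - T j) = \<gamma>) \<and>
      (\<forall>u \<in> insert 1 (U \<union> (\<lambda>j. T i - T j) ` I). \<forall>n. u \<noteq> 0 \<longrightarrow> \<gamma>' < n \<longrightarrow> n \<le> \<gamma> \<longrightarrow>
            n > ?m u + K \<or> ?m u > n + K)"
    then have lt: "\<gamma>' < \<gamma>" by blast
    have alt: "T i - T j \<noteq> 0 \<and> ?m (z' - T j) = ?m (T i - T j) \<and> ?m (z - T j) = ?m (T i - T j) \<or>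
            ?m (z' - T j) = \<gamma>' \<and> ?m (z - T j) = \<gamma>" if "j \<in> I" for j
      using d that by auto
    have "\<forall>n. \<gamma>' < n \<longrightarrow> n \<le> \<gamma> \<longrightarrow> n > ?m (T i - T j) + K \<or> ?m (T i - T j) > n + K"
      if "j \<in> I" "T i - T j \<noteq> 0" for j using d that by blast
    note cmp' = cmp[OF mc[OF that(1)] mc[OF that(2)] lt _ this]
      cmp[OF mc[OF that(2)] mc[OF that(1)] lt _ this]
    \<comment> \<open>A comparison could only change if exactly one of the two valuations is
      lowered; \<open>cmp'\<close> covers these mixed cases.\<close>
    from alt[OF that(1)] alt[OF that(2)] show ?thesis
    proof (elim disjE conjE)
      assume *: "T i - T f \<noteq> 0" "?m (z' - T f) = ?m (T i - T f)" "?m (z - T f) = ?m (T i - T f)"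
        "?m (z' - T g) = \<gamma>'" "?m (z - T g) = \<gamma>"
      show ?thesis unfolding *(2-5) by (rule cmp'(4)) (use * that in auto)
    next
      assume *: "T i - T g \<noteq> 0" "?m (z' - T g) = ?m (T i - T g)" "?m (z - T g) = ?m (T i - T g)"
        "?m (z' - T f) = \<gamma>'" "?m (z - T f) = \<gamma>"
      show ?thesis unfolding *(2-5) by (rule cmp'(1)) (use * that in auto)
    qed (use lt in simp_all)
  qed
  have IC: "?m (c f) + ?m (z' - T f) \<le> ?m A + ?m v \<longleftrightarrow> ?m (c f) + ?m (z - T f) \<le> ?m A + ?m v"
           "?m A + ?m v \<le> ?m (c f) + ?m (z' - T f) \<longleftrightarrow> ?m A + ?m v \<le> ?m (c f) + ?m (z - T f)"
    if "f \<in> I" "v \<in> U" "v \<noteq> 0" for f v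
    using descent cmp[OF mc[OF that(1)] le_refl _ that(3)] that by auto
  have main: "vp p (c f * num + t f * d) \<le> vp p (c g * num + t g * d) \<longleftrightarrow>
      vp p (c f * a + t f) \<le> vp p (c g * a + t g)" if "f \<in> F" "g \<in> F" for f g
  proof (cases "f \<in> I"; cases "g \<in> I")
    assume I: "f \<in> I" "g \<in> I"
    have "?m (c f * num + t f * d) \<le> ?m (c g * num + t g * d) \<longleftrightarrow> ?m (c f * a + t f) \<le> ?m (c g * a + t g)"
      using II[OF I] mold[OF I(1)] mold[OF I(2)] mnew[OF I(1)] mnew[OF I(2)] by linarith
    then show ?thesis using I nz nz' by (simp add: vp_le_iff[OF p] I_def flip: q_def)
  next
    assume I: "f \<in> I" "g \<notin> I"
    then have g: "c g = 0" "t g \<in> U" using that by (auto simp: I_def U_def)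
    have "?m (c f * num + t f * d) \<le> ?m (t g * d) \<longleftrightarrow> ?m (c f * a + t f) \<le> ?m (t g)" if "t g \<noteq> 0"
      using IC(1)[OF I(1) g(2) that] mold[OF I(1)] mnew[OF I(1)] mconst[OF that] by linarith
    then show ?thesis using I g nz nz' A0 q0 by (auto simp: vp_le_iff[OF p] I_def d_def simp flip: q_def)
  next
    assume I: "f \<notin> I" "g \<in> I"
    then have f: "c f = 0" "t f \<in> U" using that by (auto simp: I_def U_def)
    have "?m (t f * d) \<le> ?m (c g * num + t g * d) \<longleftrightarrow> ?m (t f) \<le> ?m (c g * a + t g)" if "t f \<noteq> 0"
      using IC(2)[OF I(2) f(2) that] mold[OF I(2)] mnew[OF I(2)] mconst[OF that] by linarith
    then show ?thesis using I f nz nz' A0 q0 by (auto simp: vp_le_iff[OF p] I_def d_def simp flip: q_def)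
  next
    assume I: "f \<notin> I" "g \<notin> I"
    then have "c f = 0" "c g = 0" using that by (auto simp: I_def)
    then show ?thesis using mconst[of f] mconst[of g] A0 q0
      by (auto simp: vp_le_iff[OF p] d_def simp flip: q_def)
  qed
  \<comment> \<open>The form \<open>k1\<close> makes 1 one of the constants, so the direction 1 of
    the descent requires no separate test points.\<close>
  have "1 \<in> U" using one by (force simp: U_def)
  then have u: "u \<in> U \<union> (\<lambda>j. T i - T j) ` I" using *(2) by auto
  show ?thesis
    by (rule that[of i u r E num d])
      (use * u main nz' in \<open>simp_all add: I_def U_def num_def d_def flip: q_def\<close>)
qed

section \<open>p-adic approximation by integers, first for one prime, then for several\<close>

lemma vp_approx:
  assumes "prime p" and "int p ^ M dvd s - s'" and "s' \<noteq> 0" and "multiplicity (int p) s' < M"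
  shows "vp p s = vp p s'"
  using multiplicity_approx[OF _ assms(2-4)] assms by (simp add: vp_nonzero)

lemma vp_mult_le_cancel:
  assumes "prime p" and "d \<noteq> 0"
  shows "vp p (d * s) \<le> vp p (d * s') \<longleftrightarrow> vp p s \<le> vp p s'"
proof -
  have "prime_elem (int p)" using assms(1) by (simp add: prime_imp_prime_elem)
  then show ?thesis using assms
    by (auto simp: vp_le_iff prime_elem_multiplicity_mult_distrib[of "int p"])
qed

text \<open>After cancellation of the power of \<open>p\<close> in \<open>d\<close>, the denominator
  is invertible modulo \<open>p ^ M\<close>, so the p-adic integer \<open>num / d\<close> can be
  approximated by integers.\<close>

lemma approximate_fraction:
  fixes d num :: int
  assumes p: "prime p" and "d \<noteq> 0" and "vp p d \<le> vp p num"
  obtains a where "int p ^ M dvd d * a - num"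
proof -
  define q where "q = int p"
  have q: "prime q" using p by (simp add: q_def)
  let ?m = "multiplicity q d"
  have nu: "\<not> is_unit q" using q by (auto dest: not_prime_unit)
  obtain d' where d': "d = q ^ ?m * d'" "\<not> q dvd d'"
    using multiplicity_decompose'[OF assms(2) nu] by metis
  have "q ^ ?m dvd num"
    using assms by (auto simp: vp_le_iff q_def intro: multiplicity_dvd')
  then obtain n' where n': "num = q ^ ?m * n'" by blast
  have "coprime d' (q ^ M)" using q d'(2) by (metis coprime_commute coprime_power_right_iff prime_imp_coprime)
  then obtain w k where w: "w * d' + k * q ^ M = 1"
    by (metis bezout_int coprime_imp_gcd_eq_1)
  have "d * (w * n') - num = q ^ ?m * (n' * (w * d' - 1))"
    by (subst d'(1), subst n') (simp add: algebra_simps)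
  also have "w * d' - 1 = q ^ M * (- k)" using w by (simp add: algebra_simps)
  finally have "q ^ M dvd d * (w * n') - num" by simp
  then show ?thesis using that by (simp add: q_def)
qed

text \<open>Converse to \<open>test_point\<close>: the conditions on the fraction are open, so they
  survive at an integer close enough to it. The precision \<open>M\<close> exceeds the
  multiplicities of all the values; constant forms are not perturbed at all.\<close>

lemma integral_test_point:
  fixes num d :: int and c t :: "'i \<Rightarrow> int" and p :: nat
  assumes p: "prime p" and F: "finite F" and d: "d \<noteq> 0" "vp p d \<le> vp p num"
    and nz: "\<And>f. f \<in> F \<Longrightarrow> c f \<noteq> 0 \<Longrightarrow> c f * num + t f * d \<noteq> 0"
  obtains a where
    "\<And>f. f \<in> F \<Longrightarrow> c f \<noteq> 0 \<Longrightarrow> c f * a + t f \<noteq> 0"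
    and "\<And>f g. f \<in> F \<Longrightarrow> g \<in> F \<Longrightarrow>
      vp p (c f * a + t f) \<le> vp p (c g * a + t g) \<longleftrightarrow>
      vp p (c f * num + t f * d) \<le> vp p (c g * num + t g * d)"
proof -
  let ?v = "\<lambda>f. c f * num + t f * d"
  define M where "M = Suc (\<Sum>f\<in>F. multiplicity (int p) (?v f))"
  have M: "multiplicity (int p) (?v f) < M" if "f \<in> F" for f
    unfolding M_def less_Suc_eq_le using F that by (intro member_le_sum) auto
  obtain a where a: "int p ^ M dvd d * a - num" using approximate_fraction[OF p d] by blast
  have dv: "int p ^ M dvd d * (c f * a + t f) - ?v f" for f
  proof -
    have "d * (c f * a + t f) - ?v f = c f * (d * a - num)" by (simp add: algebra_simps)
    then show ?thesis using a by simp
  qed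
  have vp: "vp p (d * (c f * a + t f)) = vp p (?v f)" if "f \<in> F" for f
  proof (cases "c f = 0")
    case True
    then show ?thesis by (simp add: mult.commute)
  next
    case False
    then show ?thesis using vp_approx[OF p dv nz[OF that] M[OF that]] by simp
  qed
  have "c f * a + t f \<noteq> 0" if "f \<in> F" "c f \<noteq> 0" for f
    using multiplicity_approx[OF _ dv nz[OF that] M[OF that(1)]] p by auto
  moreover have "vp p (c f * a + t f) \<le> vp p (c g * a + t g) \<longleftrightarrow> vp p (?v f) \<le> vp p (?v g)"
    if "f \<in> F" "g \<in> F" for f g
    using vp_mult_le_cancel[OF p d(1), of "c f * a + t f" "c g * a + t g"] vp that by simp
  ultimately show ?thesis using that by blast
qed

text \<open>Chinese remainder theorem for moduli that need not be coprime: \<open>N\<close> may be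
  divisible by primes in \<open>Q\<close>, and the hypothesis on \<open>b p - r\<close> says that
  both prescriptions agree modulo the power of \<open>p\<close> in \<open>N\<close>. The induction
  adjusts \<open>a\<close> at one prime at a time.\<close>

lemma simultaneous_approximation:
  fixes N r :: int and b :: "nat \<Rightarrow> int"
  assumes "finite Q" and "\<And>p. p \<in> Q \<Longrightarrow> prime p" and N: "N \<noteq> 0"
    and "\<And>p. p \<in> Q \<Longrightarrow> vp p N \<le> vp p (b p - r)"
  shows "\<exists>a. N dvd a - r \<and> (\<forall>p\<in>Q. int p ^ M dvd a - b p)"
  using assms
proof (induction Q)
  case empty
  then show ?case by (auto intro: exI[of _ r])
next
  case (insert p Q)
  then obtain a where a: "N dvd a - r" "\<And>p'. p' \<in> Q \<Longrightarrow> int p' ^ M dvd a - b p'" by auto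
  define q where "q = int p"
  have p: "prime p" using insert.prems(1) by simp
  then have q: "prime q" by (simp add: q_def)
  define W where "W = (\<Prod>p'\<in>Q. int p' ^ M)"
  let ?k = "multiplicity q N"
  have nu: "\<not> is_unit q" using q by (auto dest: not_prime_unit)
  obtain N' where N': "N = q ^ ?k * N'" "\<not> q dvd N'"
    using multiplicity_decompose'[OF N nu] by metis
  have "q ^ ?k dvd b p - r"
    using insert.prems(3)[of p] p by (auto simp: vp_le_iff q_def intro: multiplicity_dvd')
  moreover have "q ^ ?k dvd a - r" using a(1) multiplicity_dvd dvd_trans by blast
  ultimately have "q ^ ?k dvd (a - r) - (b p - r)" by (rule dvd_diff[rotated])
  then obtain w where w: "a - b p = q ^ ?k * w" by auto
  have "coprime (N' * W) (q ^ M)"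
  proof -
    have "coprime q (int p' ^ M)" if "p' \<in> Q" for p'
      using primes_coprime[of p p'] p insert.prems(1)[of p'] insert.hyps that
      by (auto simp: q_def)
    then have "coprime q W" unfolding W_def by (rule prod_coprime_right)
    moreover have "coprime q N'" using q N'(2) by (rule prime_imp_coprime)
    ultimately show ?thesis by (simp add: coprime_commute)
  qed
  then obtain x y where xy: "x * (N' * W) + y * q ^ M = 1"
    by (metis bezout_int coprime_imp_gcd_eq_1)
  \<comment> \<open>The correction is a multiple of \<open>N * W\<close>, so it preserves the
    congruences already achieved. As \<open>x\<close> inverts \<open>N' * W\<close> modulo
    \<open>q ^ M\<close>, it cancels the error \<open>q ^ ?k * w\<close> to that precision.\<close>
  define a' where "a' = a - N * W * (w * x)"
  have "a' - b p = q ^ ?k * w - q ^ ?k * N' * W * (w * x)"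
    using w N'(1) by (simp add: a'_def algebra_simps)
  also have "\<dots> = q ^ ?k * w * (1 - x * (N' * W))" by (simp add: algebra_simps)
  also have "1 - x * (N' * W) = y * q ^ M" using xy by simp
  finally have "q ^ M dvd a' - b p" by simp
  moreover have "int p' ^ M dvd a' - b p'" if "p' \<in> Q" for p'
  proof -
    have "int p' ^ M dvd W" unfolding W_def using insert.hyps(1) that by (rule dvd_prodI)
    then have "int p' ^ M dvd (a - b p') - N * W * (w * x)" using a(2)[OF that] by simp
    then show ?thesis by (simp add: a'_def algebra_simps)
  qed
  moreover have "N dvd a' - r"
  proof -
    have "N dvd (a - r) - N * W * (w * x)" using a(1) by simp
    then show ?thesis by (simp add: a'_def algebra_simps)
  qed
  ultimately show ?case by (auto simp: q_def)
qed

text \<open>An approximation of all \<open>b p\<close> beyond the valuations of the values there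
  leaves these valuations unchanged. That \<open>a\<close> is not a root is read off at a single
  prime, which is why \<open>Q\<close> has to be nonempty.\<close>

lemma glue_local_solutions:
  fixes N r :: int and c t :: "'i \<Rightarrow> int" and b :: "nat \<Rightarrow> int"
  assumes Q: "finite Q" "Q \<noteq> {}" "\<And>p. p \<in> Q \<Longrightarrow> prime p" and N: "N \<noteq> 0" and F: "finite F"
    and b: "\<And>p. p \<in> Q \<Longrightarrow> vp p N \<le> vp p (b p - r)"
    and nz: "\<And>p f. p \<in> Q \<Longrightarrow> f \<in> F \<Longrightarrow> c f \<noteq> 0 \<Longrightarrow> c f * b p + t f \<noteq> 0"
  obtains a where "N dvd a - r" and "\<And>f. f \<in> F \<Longrightarrow> c f \<noteq> 0 \<Longrightarrow> c f * a + t f \<noteq> 0"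
    and "\<And>p f. p \<in> Q \<Longrightarrow> f \<in> F \<Longrightarrow> vp p (c f * a + t f) = vp p (c f * b p + t f)"
proof -
  define M where "M = Suc (\<Sum>(p, f)\<in>Q\<times>F. multiplicity (int p) (c f * b p + t f))"
  have M: "multiplicity (int p) (c f * b p + t f) < M" if "p \<in> Q" "f \<in> F" for p f
    unfolding M_def less_Suc_eq_le
    using Q(1) F that member_le_sum[of "(p, f)" "Q \<times> F" "\<lambda>(p, f). multiplicity (int p) (c f * b p + t f)"]
    by auto
  obtain a where a: "N dvd a - r" "\<And>p. p \<in> Q \<Longrightarrow> int p ^ M dvd a - b p"
    using simultaneous_approximation[OF Q(1,3) N b, of M] by auto
  have dv: "int p ^ M dvd (c f * a + t f) - (c f * b p + t f)" if "p \<in> Q" for p f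
  proof -
    have "(c f * a + t f) - (c f * b p + t f) = c f * (a - b p)" by (simp add: algebra_simps)
    then show ?thesis using a(2)[OF that] by simp
  qed
  show ?thesis
  proof (rule that[OF a(1)])
    fix f assume f: "f \<in> F" "c f \<noteq> 0"
    obtain p where p: "p \<in> Q" using Q(2) by blast
    show "c f * a + t f \<noteq> 0"
      using multiplicity_approx[OF _ dv nz M] p f Q(3) by auto
  next
    fix p f assume pf: "p \<in> Q" "f \<in> F"
    show "vp p (c f * a + t f) = vp p (c f * b p + t f)"
      using vp_approx[OF Q(3) dv nz M] pf by (cases "c f = 0") auto
  qed
qed

lemma vp_mono_dvd: "a dvd b \<Longrightarrow> vp p a \<le> vp p b"
  unfolding vp_def by (intro Sup_subset_mono image_mono) (auto intro: dvd_trans)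

section \<open>Quantifier-free definable functions and relations\<close>

text \<open>Definability is made a property of functions and predicates on environments, so that
  equivalents can be assembled by closure rules instead of writing formulas.\<close>

definition term_definable :: "nat set \<Rightarrow> nat set \<Rightarrow> ((nat \<Rightarrow> int) \<Rightarrow> int) \<Rightarrow> bool" where
  "term_definable P V l \<longleftrightarrow>
     (\<exists>t. wf_trm (langE P) t \<and> fvt t \<subseteq> V \<and> (\<forall>e. eval ZZ e t = l e))"

definition qf_definable :: "nat set \<Rightarrow> nat set \<Rightarrow> ((nat \<Rightarrow> int) \<Rightarrow> bool) \<Rightarrow> bool" where
  "qf_definable P V S \<longleftrightarrow>
     (\<exists>\<psi>. wf_fm (langE P) \<psi> \<and> quantifier_free \<psi> \<and> fv \<psi> \<subseteq> V \<and> (\<forall>e. sat ZZ e \<psi> \<longleftrightarrow> S e))"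

lemma term_definable_mono: "term_definable P V l \<Longrightarrow> V \<subseteq> W \<Longrightarrow> term_definable P W l"
  unfolding term_definable_def by blast

lemma term_definable_var: "x \<in> V \<Longrightarrow> term_definable P V (\<lambda>e. e x)"
  unfolding term_definable_def by (rule exI[of _ "Var x"]) auto

lemma term_definable_add:
  assumes "term_definable P V l" "term_definable P V l'"
  shows "term_definable P V (\<lambda>e. l e + l' e)"
proof -
  from assms obtain s t where "wf_trm (langE P) s" "fvt s \<subseteq> V" "\<forall>e. eval ZZ e s = l e"
    "wf_trm (langE P) t" "fvt t \<subseteq> V" "\<forall>e. eval ZZ e t = l' e"
    unfolding term_definable_def by blast
  then show ?thesis unfolding term_definable_def
    by (intro exI[of _ "Fun Plus [s, t]"]) (auto simp: ZZ_def langE_def lang_def)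
qed

lemma term_definable_uminus:
  assumes "term_definable P V l"
  shows "term_definable P V (\<lambda>e. - l e)"
proof -
  from assms obtain s where "wf_trm (langE P) s" "fvt s \<subseteq> V" "\<forall>e. eval ZZ e s = l e"
    unfolding term_definable_def by blast
  then show ?thesis unfolding term_definable_def
    by (intro exI[of _ "Fun Minus [s]"]) (auto simp: ZZ_def langE_def lang_def)
qed

lemma term_definable_diff:
  "term_definable P V l \<Longrightarrow> term_definable P V l' \<Longrightarrow> term_definable P V (\<lambda>e. l e - l' e)"
  using term_definable_add[of P V l "\<lambda>e. - l' e"] term_definable_uminus by auto

lemma term_definable_0: "term_definable P V (\<lambda>e. 0)"
  unfolding term_definable_def
  by (rule exI[of _ "Fun Zero []"]) (auto simp: ZZ_def langE_def lang_def)

lemma term_definable_1: "term_definable P V (\<lambda>e. 1)"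
  unfolding term_definable_def
  by (rule exI[of _ "Fun One []"]) (auto simp: ZZ_def langE_def lang_def)

text \<open>A multiple is an iterated sum, negated by \<open>Minus\<close> for negative
  \<open>k\<close>.\<close>

lemma term_definable_mult:
  assumes "term_definable P V l"
  shows "term_definable P V (\<lambda>e. k * l e)"
proof -
  have nat: "term_definable P V (\<lambda>e. int n * l e)" for n
  proof (induction n)
    case 0
    then show ?case using term_definable_0 by simp
  next
    case (Suc n)
    then show ?case using term_definable_add[OF assms Suc] by (simp add: algebra_simps)
  qed
  show ?thesis
  proof (cases k)
    case (nonneg n)
    then show ?thesis using nat by simp
  next
    case (neg n)
    then have "k * l e = - (int (Suc n) * l e)" for e by (simp only: mult_minus_left)
    then show ?thesis using term_definable_uminus[OF nat[of "Suc n"]] by simp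
  qed
qed

lemma term_definable_const: "term_definable P V (\<lambda>e. k)"
  using term_definable_mult[OF term_definable_1, of P V k] by simp

lemmas term_definable_intros =
  term_definable_add term_definable_uminus term_definable_diff term_definable_mult term_definable_const

lemma qf_definable_mono: "qf_definable P V S \<Longrightarrow> V \<subseteq> W \<Longrightarrow> qf_definable P W S"
  unfolding qf_definable_def by blast

lemma qf_definable_eq_0:
  assumes "term_definable P V l"
  shows "qf_definable P V (\<lambda>e. l e = 0)"
proof -
  from assms obtain s where "wf_trm (langE P) s" "fvt s \<subseteq> V" "\<forall>e. eval ZZ e s = l e"
    unfolding term_definable_def by blast
  then show ?thesis unfolding qf_definable_def
    by (intro exI[of _ "Eq s (Fun Zero [])"]) (auto simp: ZZ_def langE_def lang_def)
qed

lemma qf_definable_vp_le: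
  assumes "p \<in> P" "term_definable P V l" "term_definable P V l'"
  shows "qf_definable P V (\<lambda>e. vp p (l e) \<le> vp p (l' e))"
proof -
  from assms obtain s t where "wf_trm (langE P) s" "fvt s \<subseteq> V" "\<forall>e. eval ZZ e s = l e"
    "wf_trm (langE P) t" "fvt t \<subseteq> V" "\<forall>e. eval ZZ e t = l' e"
    unfolding term_definable_def by blast
  then show ?thesis unfolding qf_definable_def using assms(1)
    by (intro exI[of _ "Rel (VDvd p) [s, t]"]) (auto simp: ZZ_def langE_def lang_def)
qed

lemma rel_int_D: "rel_int (D n) [a] \<longleftrightarrow> int n dvd a"
  by (auto simp: dvd_def)

lemma qf_definable_dvd:
  assumes "n \<noteq> 0" "term_definable P V l"
  shows "qf_definable P V (\<lambda>e. n dvd l e)"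
proof -
  from assms obtain s where "wf_trm (langE P) s" "fvt s \<subseteq> V" "\<forall>e. eval ZZ e s = l e"
    unfolding term_definable_def by blast
  then show ?thesis unfolding qf_definable_def using assms(1)
    by (intro exI[of _ "Rel (D (nat \<bar>n\<bar>)) [s]"])
      (auto simp: ZZ_def langE_def lang_def rel_int_D simp del: rel_int.simps)
qed

text \<open>The truth values are expressed by the equations \<open>0 = 0\<close> and
  \<open>1 = 0\<close>.\<close>

lemma qf_definable_const: "qf_definable P V (\<lambda>e. b)"
  using qf_definable_eq_0[OF term_definable_const[of P V "if b then 0 else 1"]] by (simp split: if_splits)

lemma qf_definable_not:
  assumes "qf_definable P V S"
  shows "qf_definable P V (\<lambda>e. \<not> S e)"
proof -
  from assms obtain \<psi> where "wf_fm (langE P) \<psi>" "quantifier_free \<psi>" "fv \<psi> \<subseteq> V" "\<forall>e. sat ZZ e \<psi> = S e"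
    unfolding qf_definable_def by blast
  then show ?thesis unfolding qf_definable_def by (intro exI[of _ "Neg \<psi>"]) auto
qed

lemma qf_definable_conj:
  assumes "qf_definable P V S" "qf_definable P V S'"
  shows "qf_definable P V (\<lambda>e. S e \<and> S' e)"
proof -
  from assms obtain \<psi> \<psi>' where "wf_fm (langE P) \<psi>" "quantifier_free \<psi>" "fv \<psi> \<subseteq> V" "\<forall>e. sat ZZ e \<psi> = S e"
    "wf_fm (langE P) \<psi>'" "quantifier_free \<psi>'" "fv \<psi>' \<subseteq> V" "\<forall>e. sat ZZ e \<psi>' = S' e"
    unfolding qf_definable_def by blast
  then show ?thesis unfolding qf_definable_def by (intro exI[of _ "And \<psi> \<psi>'"]) auto
qed

lemma qf_definable_disj:
  "qf_definable P V S \<Longrightarrow> qf_definable P V S' \<Longrightarrow> qf_definable P V (\<lambda>e. S e \<or> S' e)"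
  using qf_definable_not[OF qf_definable_conj[OF qf_definable_not qf_definable_not], of P V S S'] by simp

lemma qf_definable_iff_const:
  "qf_definable P V S \<Longrightarrow> qf_definable P V (\<lambda>e. S e \<longleftrightarrow> b)"
  using qf_definable_not[of P V S] by (cases b) auto

lemma qf_definable_ball:
  assumes "finite I" "\<And>i. i \<in> I \<Longrightarrow> qf_definable P V (S i)"
  shows "qf_definable P V (\<lambda>e. \<forall>i\<in>I. S i e)"
  using assms
proof (induction I)
  case empty
  then show ?case using qf_definable_const[of P V True] by simp
next
  case (insert i I)
  then show ?case using qf_definable_conj[of P V "S i" "\<lambda>e. \<forall>i\<in>I. S i e"] by simp
qed

lemma qf_definable_bex:
  assumes "finite I" "\<And>i. i \<in> I \<Longrightarrow> qf_definable P V (S i)"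
  shows "qf_definable P V (\<lambda>e. \<exists>i\<in>I. S i e)"
  using qf_definable_not[OF qf_definable_ball[OF assms(1), of P V "\<lambda>i e. \<not> S i e"]]
    qf_definable_not assms(2) by simp

section \<open>Elimination of one quantifier\<close>

text \<open>The pair \<open>(c, l)\<close> stands for the affine function \<open>a \<mapsto> c * a + l e\<close>, where \<open>e\<close> interprets the
  parameters.\<close>

type_synonym form = "int \<times> ((nat \<Rightarrow> int) \<Rightarrow> int)"

definition form_val :: "form \<Rightarrow> (nat \<Rightarrow> int) \<Rightarrow> int \<Rightarrow> int" where
  "form_val f e a = fst f * a + snd f e"

text \<open>\<open>test_point\<close> and \<open>integral_test_point\<close> together replace
  \<open>\<exists>a\<close> by a finite disjunction over fractions with numerators in
  \<open>C\<close> and the common denominator \<open>d\<close>. The forms 1 and \<open>a\<close>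
  belong to \<open>F\<close> so that p-adic integrality of a fraction is among the comparisons that
  \<open>test_point\<close> preserves.\<close>

lemma local_solvability_definable:
  fixes F :: "form set"
  assumes p: "p \<in> P" "prime p" and F: "finite F" "\<And>f. f \<in> F \<Longrightarrow> term_definable P V (snd f)"
    and one: "(0, \<lambda>_. 1) \<in> F" and var: "(1, \<lambda>_. 0) \<in> F"
    and R: "finite R" "\<And>f g b. (f, g, b) \<in> R \<Longrightarrow> f \<in> F \<and> g \<in> F"
  shows "qf_definable P V (\<lambda>e. \<exists>a. (\<forall>f\<in>F. fst f \<noteq> 0 \<longrightarrow> form_val f e a \<noteq> 0) \<and>
    (\<forall>(f, g, b)\<in>R. (vp p (form_val f e a) \<le> vp p (form_val g e a)) = b))"
proof -
  define G where "G = {f\<in>F. fst f \<noteq> 0}"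
  define A where "A = (\<Prod>f\<in>G. fst f)"
  define K where "K = multiplicity (int p) A + 1"
  define T where "T f e = - (A div fst f) * snd f e" for f :: form and e
  define U where "U i = snd ` {f\<in>F. fst f = 0} \<union> (\<lambda>j e. T i e - T j e) ` G" for i
  define d where "d = A * int p ^ K"
  \<comment> \<open>Any numerator that satisfies \<open>L'\<close> leads to a solution, so
    \<open>C\<close> only has to contain the test points; hence the generous range of
    \<open>r\<close>.\<close>
  define C where "C = (\<lambda>(i, u, r, E) e. int p ^ K * T i e + r * int p ^ E * u e) `
    (SIGMA i:G. U i \<times> {0..int p} \<times> {..2 * K})"
  define L where "L e a \<longleftrightarrow> (\<forall>f\<in>F. fst f \<noteq> 0 \<longrightarrow> form_val f e a \<noteq> 0) \<and>
    (\<forall>(f, g, b)\<in>R. (vp p (form_val f e a) \<le> vp p (form_val g e a)) = b)" for e a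
  \<comment> \<open>The first conjunct says that \<open>num e / d\<close> is a p-adic integer; the
    others are those of \<open>L\<close> at this fraction, multiplied by \<open>d\<close>.\<close>
  define L' where "L' num e \<longleftrightarrow> vp p d \<le> vp p (num e) \<and>
    (\<forall>f\<in>G. \<not> fst f * num e + d * snd f e = 0) \<and>
    (\<forall>x\<in>R. (vp p (fst (fst x) * num e + d * snd (fst x) e)
      \<le> vp p (fst (fst (snd x)) * num e + d * snd (fst (snd x)) e)) = snd (snd x))" for num e
  have finG: "finite G" using F by (simp add: G_def)
  have A0: "A \<noteq> 0" using finG by (auto simp: A_def G_def)
  have d0: "d \<noteq> 0" using A0 p by (auto simp: d_def)
  have finU: "finite (U i)" for i using F finG by (simp add: U_def)
  have finC: "finite C" unfolding C_def using finG finU by (intro finite_imageI finite_SigmaI) auto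
  have defT: "term_definable P V (T f)" if "f \<in> G" for f
    unfolding T_def using F that by (intro term_definable_intros) (auto simp: G_def)
  have defU: "term_definable P V u" if "u \<in> U i" "i \<in> G" for u i
    using that F defT[of i] defT term_definable_diff[of P V "T i"] unfolding U_def by blast
  have defC: "term_definable P V num" if num: "num \<in> C" for num
  proof -
    obtain i u r E where "i \<in> G" "u \<in> U i" "num = (\<lambda>e. int p ^ K * T i e + r * int p ^ E * u e)"
      using num by (auto simp: C_def)
    then show ?thesis using defT[of i] defU[of u i] by (auto intro!: term_definable_add term_definable_mult)
  qed
  have eq: "(\<exists>a. L e a) \<longleftrightarrow> (\<exists>num\<in>C. L' num e)" for e
  proof
    assume "\<exists>a. L e a"
    then obtain a where a: "L e a" by blast
    obtain i u r E num d1 where *: "i \<in> F" "fst i \<noteq> 0"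
      "u \<in> (\<lambda>f. snd f e) ` {f\<in>F. fst f = 0} \<union> (\<lambda>j. T i e - T j e) ` {f\<in>F. fst f \<noteq> 0}"
      "0 < r" "r < int p" "E \<le> 2 * K" "num = int p ^ K * T i e + r * int p ^ E * u" "d1 = A * int p ^ K"
      "\<And>f. f \<in> F \<Longrightarrow> fst f \<noteq> 0 \<Longrightarrow> fst f * num + snd f e * d1 \<noteq> 0"
      "\<And>f g. f \<in> F \<Longrightarrow> g \<in> F \<Longrightarrow>
      vp p (fst f * num + snd f e * d1) \<le> vp p (fst g * num + snd g e * d1) \<longleftrightarrow>
      vp p (fst f * a + snd f e) \<le> vp p (fst g * a + snd g e)"
      by (rule test_point[where F=F and c=fst and t="\<lambda>f. snd f e" and T="\<lambda>f. T f e" and a=a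
            and A=A and K=K, OF p(2) F(1) one _ _ var])
        (use a in \<open>auto simp: L_def form_val_def A_def G_def K_def T_def\<close>)
    obtain u' where u': "u' \<in> U i" "u = u' e" using *(3) by (auto simp: U_def G_def)
    define num' where "num' = (\<lambda>e. int p ^ K * T i e + r * int p ^ E * u' e)"
    have "num' \<in> C" unfolding C_def num'_def
      using * u' by (intro image_eqI[of _ _ "(i, u', r, E)"]) (auto simp: G_def)
    moreover have num': "num' e = num" "d1 = d" using * u' by (auto simp: num'_def d_def)
    \<comment> \<open>The valuation of 1 is at most that of the integer \<open>a\<close>; this
      comparison transfers to \<open>d\<close> and \<open>num\<close>.\<close>
    have "vp p d \<le> vp p num" using *(10)[OF one var] num'
      by (simp add: vp_mono_dvd)
    moreover have "(vp p (fst f * num + d * snd f e) \<le> vp p (fst g * num + d * snd g e)) = b"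
      if "(f, g, b) \<in> R" for f g b
      using R(2)[OF that] *(10)[of f g] a that unfolding L_def form_val_def num'(2)
      by (fastforce simp: mult.commute)
    ultimately show "\<exists>num\<in>C. L' num e"
      using *(9) num' by (intro bexI[of _ num']) (auto simp: L'_def G_def mult.commute)
  next
    assume "\<exists>num\<in>C. L' num e"
    then obtain num where num: "L' num e" by blast
    obtain a where a: "\<And>f. f \<in> F \<Longrightarrow> fst f \<noteq> 0 \<Longrightarrow> fst f * a + snd f e \<noteq> 0"
      "\<And>f g. f \<in> F \<Longrightarrow> g \<in> F \<Longrightarrow>
      vp p (fst f * a + snd f e) \<le> vp p (fst g * a + snd g e) \<longleftrightarrow>
      vp p (fst f * num e + snd f e * d) \<le> vp p (fst g * num e + snd g e * d)"
      by (rule integral_test_point[where F=F and c=fst and t="\<lambda>f. snd f e" and num="num e" and d=d,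
            OF p(2) F(1) d0]) (use num in \<open>auto simp: L'_def G_def mult.commute\<close>)
    have "(vp p (fst f * a + snd f e) \<le> vp p (fst g * a + snd g e)) = b" if "(f, g, b) \<in> R" for f g b
      using R(2)[OF that] a(2)[of f g] num that unfolding L'_def by (fastforce simp: mult.commute)
    then have "L e a" using a(1) by (auto simp: L_def form_val_def)
    then show "\<exists>a. L e a" by blast
  qed
  have "qf_definable P V (L' num)" if "num \<in> C" for num
    unfolding L'_def
    by (intro qf_definable_conj qf_definable_ball qf_definable_iff_const qf_definable_not
        qf_definable_eq_0 qf_definable_vp_le term_definable_intros finG R(1) p(1) defC[OF that] F(2))
      (use R(2) in \<open>auto simp: G_def\<close>)
  then have "qf_definable P V (\<lambda>e. \<exists>num\<in>C. L' num e)" by (intro qf_definable_bex finC)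
  then show ?thesis by (simp only: eq[symmetric] L_def)
qed

section \<open>Atoms and the solvability of prescribed truth values\<close>

datatype atom = ZeroA form | ValA nat form form | DivA nat form

primrec holds :: "(nat \<Rightarrow> int) \<Rightarrow> int \<Rightarrow> atom \<Rightarrow> bool" where
  "holds e a (ZeroA f) \<longleftrightarrow> form_val f e a = 0"
| "holds e a (ValA p f g) \<longleftrightarrow> vp p (form_val f e a) \<le> vp p (form_val g e a)"
| "holds e a (DivA n f) \<longleftrightarrow> int n dvd form_val f e a"

primrec atom_forms :: "atom \<Rightarrow> form set" where
  "atom_forms (ZeroA f) = {f}"
| "atom_forms (ValA p f g) = {f, g}"
| "atom_forms (DivA n f) = {f}"

primrec atom_primes :: "atom \<Rightarrow> nat set" where
  "atom_primes (ZeroA f) = {}"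
| "atom_primes (ValA p f g) = {p}"
| "atom_primes (DivA n f) = {}"

primrec atom_moduli :: "atom \<Rightarrow> nat set" where
  "atom_moduli (ZeroA f) = {}"
| "atom_moduli (ValA p f g) = {}"
| "atom_moduli (DivA n f) = {n}"

definition atom_over :: "nat set \<Rightarrow> nat set \<Rightarrow> atom \<Rightarrow> bool" where
  "atom_over P V \<alpha> \<longleftrightarrow> (\<forall>f\<in>atom_forms \<alpha>. term_definable P V (snd f)) \<and>
     atom_primes \<alpha> \<subseteq> P \<and> 0 \<notin> atom_moduli \<alpha>"

lemma finite_atom_parts:
  "finite (atom_forms \<alpha>)" "finite (atom_primes \<alpha>)" "finite (atom_moduli \<alpha>)"
  by (cases \<alpha>; simp)+

text \<open>The atom at \<open>a = num / d\<close>, cleared of the denominator. In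
  \<open>DivA\<close> the modulus is scaled too, so that the condition is again atomic.\<close>

primrec holds_frac :: "(nat \<Rightarrow> int) \<Rightarrow> int \<Rightarrow> int \<Rightarrow> atom \<Rightarrow> bool" where
  "holds_frac e num d (ZeroA f) \<longleftrightarrow> fst f * num + d * snd f e = 0"
| "holds_frac e num d (ValA p f g) \<longleftrightarrow>
     vp p (fst f * num + d * snd f e) \<le> vp p (fst g * num + d * snd g e)"
| "holds_frac e num d (DivA n f) \<longleftrightarrow> d * int n dvd fst f * num + d * snd f e"

lemma holds_frac_iff:
  assumes "d \<noteq> 0" and "d * a = num" and "\<forall>p\<in>atom_primes \<alpha>. prime p"
  shows "holds_frac e num d \<alpha> \<longleftrightarrow> holds e a \<alpha>"
proof -
  have "fst f * num + d * snd f e = d * form_val f e a" for f :: form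
    using assms(2) by (auto simp: form_val_def algebra_simps)
  then show ?thesis using assms(1,3) by (cases \<alpha>) (simp_all add: vp_mult_le_cancel)
qed

lemma qf_definable_holds_frac:
  assumes "atom_over P V \<alpha>" and "term_definable P V num" and "d \<noteq> 0"
  shows "qf_definable P V (\<lambda>e. holds_frac e (num e) d \<alpha>)"
  using assms
  by (cases \<alpha>) (auto simp: atom_over_def
      intro!: qf_definable_eq_0 qf_definable_vp_le qf_definable_dvd term_definable_add term_definable_mult)

text \<open>The only root of \<open>f\<close> is \<open>- snd f e / fst f\<close>, an integer
  exactly if \<open>fst f\<close> divides \<open>snd f e\<close>; the atoms are evaluated at this
  fraction.\<close>

lemma root_case_definable:
  assumes At: "finite At" "\<And>\<alpha>. \<alpha> \<in> At \<Longrightarrow> atom_over P V \<alpha>" and P: "\<forall>p\<in>P. prime p"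
    and f: "term_definable P V (snd f)" "fst f \<noteq> 0"
  shows "qf_definable P V (\<lambda>e. \<exists>a. form_val f e a = 0 \<and> (\<forall>\<alpha>\<in>At. holds e a \<alpha> = (\<alpha> \<in> S)))"
proof -
  have pr: "\<forall>p\<in>atom_primes \<alpha>. prime p" if "\<alpha> \<in> At" for \<alpha>
    using At(2)[OF that] P by (auto simp: atom_over_def)
  have "(\<exists>a. form_val f e a = 0 \<and> (\<forall>\<alpha>\<in>At. holds e a \<alpha> = (\<alpha> \<in> S))) \<longleftrightarrow>
    fst f dvd snd f e \<and> (\<forall>\<alpha>\<in>At. holds_frac e (- snd f e) (fst f) \<alpha> = (\<alpha> \<in> S))" (is "?l \<longleftrightarrow> ?r") for e
  proof
    assume ?l
    then obtain a where a: "form_val f e a = 0" "\<forall>\<alpha>\<in>At. holds e a \<alpha> = (\<alpha> \<in> S)" by blast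
    then have eq: "fst f * a = - snd f e" by (simp add: form_val_def)
    then have "fst f dvd - snd f e" by (metis dvd_triv_left)
    then show ?r using a holds_frac_iff[OF f(2) eq] pr by simp
  next
    assume r: ?r
    then have "fst f dvd - snd f e" by simp
    then obtain a where eq: "fst f * a = - snd f e" by (metis dvdE)
    then have "form_val f e a = 0" by (simp add: form_val_def)
    then show ?l using r holds_frac_iff[OF f(2) eq] pr by auto
  qed
  moreover have "qf_definable P V (\<lambda>e. fst f dvd snd f e \<and>
      (\<forall>\<alpha>\<in>At. holds_frac e (- snd f e) (fst f) \<alpha> = (\<alpha> \<in> S)))"
    by (intro qf_definable_conj qf_definable_dvd qf_definable_ball qf_definable_iff_const
        qf_definable_holds_frac At term_definable_uminus f)
  ultimately show ?thesis by simp
qed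

text \<open>Whether \<open>\<alpha>\<close> belongs to \<open>S\<close> as it should at every \<open>a\<close> that is congruent to \<open>r\<close> modulo the
  moduli and is not a root of a nonconstant form; valuation atoms impose no condition here.\<close>

primrec residue_condition :: "atom set \<Rightarrow> int \<Rightarrow> (nat \<Rightarrow> int) \<Rightarrow> atom \<Rightarrow> bool" where
  "residue_condition S r e (ZeroA f) \<longleftrightarrow> (fst f = 0 \<and> snd f e = 0) = (ZeroA f \<in> S)"
| "residue_condition S r e (ValA p f g) \<longleftrightarrow> True"
| "residue_condition S r e (DivA n f) \<longleftrightarrow> (int n dvd fst f * r + snd f e) = (DivA n f \<in> S)"

lemma qf_definable_residue_condition:
  assumes "atom_over P V \<alpha>"
  shows "qf_definable P V (\<lambda>e. residue_condition S r e \<alpha>)"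
  using assms
  by (cases \<alpha>) (auto simp: atom_over_def
      intro!: qf_definable_const qf_definable_iff_const qf_definable_conj qf_definable_eq_0
        qf_definable_dvd term_definable_add term_definable_const)

text \<open>Apart from roots, solvability amounts to a residue modulo \<open>N\<close> together with
  one local condition for each prime. Local solutions can be glued because all of them are required
  to be p-adically congruent to the same residue.\<close>

lemma atom_type_solvability_definable:
  assumes P: "P \<noteq> {}" "\<forall>p\<in>P. prime p"
    and At: "finite At" "\<And>\<alpha>. \<alpha> \<in> At \<Longrightarrow> atom_over P V \<alpha>"
  shows "qf_definable P V (\<lambda>e. \<exists>a. \<forall>\<alpha>\<in>At. holds e a \<alpha> = (\<alpha> \<in> S))"
proof -
  \<comment> \<open>Even without valuation atoms \<open>Q\<close> must contain a prime, because
    gluing avoids the roots by approximation at some prime. Here \<open>P \<noteq> {}\<close>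
    enters.\<close>
  obtain p0 where p0: "p0 \<in> P" using P(1) by blast
  define Q where "Q = insert p0 (\<Union> (atom_primes ` At))"
  have "Q \<subseteq> P" using At(2) p0 by (auto simp: Q_def atom_over_def)
  then have Q: "finite Q" "Q \<noteq> {}" "\<And>p. p \<in> Q \<Longrightarrow> p \<in> P \<and> prime p"
    using At(1) P(2) by (auto simp: Q_def finite_atom_parts)
  define N where "N = int (\<Prod> (\<Union> (atom_moduli ` At)))"
  have "0 \<notin> \<Union> (atom_moduli ` At)" using At(2) by (auto simp: atom_over_def)
  then have "\<Prod> (\<Union> (atom_moduli ` At)) \<noteq> 0" using At(1) by (simp add: finite_atom_parts)
  then have N: "N > 0" unfolding N_def by (simp only: of_nat_0_less_iff neq0_conv)
  have dvN: "int n dvd N" if "DivA n f \<in> At" for n f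
    unfolding N_def int_dvd_int_iff using At(1) that
    by (intro dvd_prod_eqI[where a=n]) (force simp: finite_atom_parts)+
  \<comment> \<open>Comparing \<open>cN\<close> with \<open>xr r\<close> expresses congruence of
    \<open>a\<close> and \<open>r\<close> modulo the power of \<open>p\<close> in \<open>N\<close>
    as a valuation condition. With \<open>xr r\<close> in \<open>F\<close>, the point
    \<open>a = r\<close> falls under the root case.\<close>
  define cN where "cN = (0 :: int, \<lambda>_ :: nat \<Rightarrow> int. N)"
  define xr where "xr r = (1 :: int, \<lambda>_ :: nat \<Rightarrow> int. - r)" for r :: int
  define F where "F = {(0, \<lambda>_. 1), (1, \<lambda>_. 0), cN} \<union> xr ` {0..<N} \<union> \<Union> (atom_forms ` At)"
  have finF: "finite F" using At(1) by (simp add: F_def finite_atom_parts)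
  have defF: "term_definable P V (snd f)" if "f \<in> F" for f
    using that At(2) by (auto simp: F_def cN_def xr_def atom_over_def intro: term_definable_const)
  define R where "R p r = insert (cN, xr r, True)
    ((\<lambda>\<alpha>. case \<alpha> of ValA _ f g \<Rightarrow> (f, g, \<alpha> \<in> S) | _ \<Rightarrow> (cN, cN, True)) ` {\<alpha>\<in>At. p \<in> atom_primes \<alpha>})" for p r
  have finR: "finite (R p r)" for p r using At(1) by (simp add: R_def)
  have inF: "f \<in> F" if "f \<in> atom_forms \<alpha>" "\<alpha> \<in> At" for f \<alpha> using that by (auto simp: F_def)
  have memR: "(f, g, b) \<in> R p r \<longleftrightarrow> f = cN \<and> g = xr r \<and> b \<or> ValA p f g \<in> At \<and> b = (ValA p f g \<in> S)" for f g b p r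
  proof
    assume "(f, g, b) \<in> R p r"
    then show "f = cN \<and> g = xr r \<and> b \<or> ValA p f g \<in> At \<and> b = (ValA p f g \<in> S)"
      by (auto simp: R_def split: atom.splits)
  next
    assume "f = cN \<and> g = xr r \<and> b \<or> ValA p f g \<in> At \<and> b = (ValA p f g \<in> S)"
    then show "(f, g, b) \<in> R p r"
      by (auto simp: R_def intro!: image_eqI[of _ _ "ValA p f g"])
  qed
  define L where "L p r e \<longleftrightarrow> (\<exists>a. (\<forall>f\<in>F. fst f \<noteq> 0 \<longrightarrow> form_val f e a \<noteq> 0) \<and>
    (\<forall>(f, g, b)\<in>R p r. (vp p (form_val f e a) \<le> vp p (form_val g e a)) = b))" for p r e
  have defL: "qf_definable P V (L p r)" if "p \<in> Q" "r \<in> {0..<N}" for p r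
    unfolding L_def
  proof (rule local_solvability_definable)
    show "f \<in> F \<and> g \<in> F" if "(f, g, b) \<in> R p r" for f g b
      using that \<open>r \<in> {0..<N}\<close> inF[of f "ValA p f g"] inF[of g "ValA p f g"]
      unfolding memR by (auto simp: F_def)
  qed (use Q that finF defF finR in \<open>auto simp: F_def\<close>)
  have eq: "(\<exists>a. \<forall>\<alpha>\<in>At. holds e a \<alpha> = (\<alpha> \<in> S)) \<longleftrightarrow>
      (\<exists>f\<in>{f\<in>F. fst f \<noteq> 0}. \<exists>a. form_val f e a = 0 \<and> (\<forall>\<alpha>\<in>At. holds e a \<alpha> = (\<alpha> \<in> S))) \<or>
      (\<exists>r\<in>{0..<N}. (\<forall>\<alpha>\<in>At. residue_condition S r e \<alpha>) \<and> (\<forall>p\<in>Q. L p r e))"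
    (is "?l \<longleftrightarrow> ?root \<or> ?generic") for e
  proof -
    have res: "residue_condition S r e \<alpha> \<longleftrightarrow> holds e a \<alpha> = (\<alpha> \<in> S)"
      if "\<alpha> \<in> At" "atom_primes \<alpha> = {}" "N dvd a - r" "\<forall>f\<in>F. fst f \<noteq> 0 \<longrightarrow> form_val f e a \<noteq> 0" for a r \<alpha>
    proof (cases \<alpha>)
      case (ZeroA f)
      then show ?thesis using that inF[of f \<alpha>] by (cases "fst f = 0") (auto simp: form_val_def)
    next
      case (ValA p f g)
      then show ?thesis using that by simp
    next
      case (DivA n f)
      have "form_val f e a = (fst f * r + snd f e) + fst f * (a - r)"
        by (simp add: form_val_def algebra_simps)
      moreover have "int n dvd fst f * (a - r)"
        using dvN[of n f] that DivA by (meson dvd_mult dvd_trans)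
      ultimately show ?thesis using DivA by (simp add: dvd_add_left_iff)
    qed
    have "?root \<or> ?generic" if a: "\<forall>\<alpha>\<in>At. holds e a \<alpha> = (\<alpha> \<in> S)" for a
    proof (cases "\<exists>f\<in>F. fst f \<noteq> 0 \<and> form_val f e a = 0")
      case True
      then show ?thesis using a by blast
    next
      case False
      define r where "r = a mod N"
      have r: "r \<in> {0..<N}" "N dvd a - r" using N by (auto simp: r_def minus_mod_eq_div_mult)
      have "residue_condition S r e \<alpha>" if "\<alpha> \<in> At" for \<alpha>
      proof (cases "atom_primes \<alpha> = {}")
        case True
        then show ?thesis using res[OF that True r(2)] False a that by blast
      next
        case False
        then show ?thesis by (cases \<alpha>) auto
      qed
      moreover have "L p r e" if "p \<in> Q" for p
        unfolding L_def
      proof (intro exI[of _ a] conjI ballI impI, goal_cases)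
        case (1 f)
        then show ?case using False by blast
      next
        case (2 x)
        have "vp p (form_val cN e a) \<le> vp p (form_val (xr r) e a)"
          using r(2) by (simp add: cN_def xr_def form_val_def vp_mono_dvd)
        moreover obtain f g b where x: "x = (f, g, b)" by (cases x)
        moreover have "holds e a (ValA p f g) = (ValA p f g \<in> S)" if "ValA p f g \<in> At"
          using a that by blast
        ultimately show ?case using 2 by (auto simp: memR)
      qed
      ultimately show ?thesis using r by blast
    qed
    moreover have ?l if r: "r \<in> {0..<N}" and rc: "\<forall>\<alpha>\<in>At. residue_condition S r e \<alpha>"
      and L: "\<forall>p\<in>Q. L p r e" for r
    proof -
      obtain b where "\<forall>p\<in>Q. (\<forall>f\<in>F. fst f \<noteq> 0 \<longrightarrow> form_val f e (b p) \<noteq> 0) \<and>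
        (\<forall>(f, g, b')\<in>R p r. (vp p (form_val f e (b p)) \<le> vp p (form_val g e (b p))) = b')"
        using bchoice[OF L[unfolded L_def]] by (elim exE)
      then have b: "\<And>p f. p \<in> Q \<Longrightarrow> f \<in> F \<Longrightarrow> fst f \<noteq> 0 \<Longrightarrow> form_val f e (b p) \<noteq> 0"
        "\<And>p f g b'. p \<in> Q \<Longrightarrow> (f, g, b') \<in> R p r \<Longrightarrow>
          (vp p (form_val f e (b p)) \<le> vp p (form_val g e (b p))) = b'"
        by blast+
      \<comment> \<open>The extra triple in \<open>R p r\<close> makes the separately chosen
        \<open>b p\<close> compatible with the congruence modulo \<open>N\<close>.\<close>
      have bN: "vp p N \<le> vp p (b p - r)" if "p \<in> Q" for p
        using b(2)[OF that, of cN "xr r" True] by (simp add: memR cN_def xr_def form_val_def)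
      obtain a where a: "N dvd a - r" "\<And>f. f \<in> F \<Longrightarrow> fst f \<noteq> 0 \<Longrightarrow> form_val f e a \<noteq> 0"
        "\<And>p f. p \<in> Q \<Longrightarrow> f \<in> F \<Longrightarrow> vp p (form_val f e a) = vp p (form_val f e (b p))"
        unfolding form_val_def
        by (rule glue_local_solutions[where Q=Q and N=N and F=F and c=fst and t="\<lambda>f. snd f e" and b=b and r=r,
              OF Q(1,2) _ _ finF bN]) (use Q N b in \<open>auto simp: form_val_def\<close>)
      have "holds e a \<alpha> = (\<alpha> \<in> S)" if \<alpha>: "\<alpha> \<in> At" for \<alpha>
      proof (cases "atom_primes \<alpha> = {}")
        case True
        then show ?thesis using res[OF \<alpha> True a(1)] a(2) rc \<alpha> by blast
      next
        case False
        then obtain p f g where [simp]: "\<alpha> = ValA p f g" by (cases \<alpha>) auto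
        have p: "p \<in> Q" using \<alpha> by (force simp: Q_def)
        have "(f, g, ValA p f g \<in> S) \<in> R p r" using \<alpha> by (simp add: memR)
        from b(2)[OF p this] show ?thesis using a(3)[OF p] inF[OF _ \<alpha>] by simp
      qed
      then show ?thesis by blast
    qed
    ultimately show ?thesis by blast
  qed
  have "qf_definable P V (\<lambda>e.
      (\<exists>f\<in>{f\<in>F. fst f \<noteq> 0}. \<exists>a. form_val f e a = 0 \<and> (\<forall>\<alpha>\<in>At. holds e a \<alpha> = (\<alpha> \<in> S))) \<or>
      (\<exists>r\<in>{0..<N}. (\<forall>\<alpha>\<in>At. residue_condition S r e \<alpha>) \<and> (\<forall>p\<in>Q. L p r e)))"
    by (intro qf_definable_disj qf_definable_bex qf_definable_conj qf_definable_ball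
        root_case_definable qf_definable_residue_condition defL At P(2) defF Q(1))
      (use finF in auto)
  then show ?thesis by (simp only: eq)
qed

section \<open>Reduction of formulas to affine forms and atoms\<close>

lemma fint_ZZ: "fint ZZ = fun_int" and rint_ZZ: "rint ZZ = rel_int"
  by (simp_all add: ZZ_def)

text \<open>No symbol multiplies two terms, so the coefficient of \<open>x\<close> is an integer
  that does not depend on the environment.\<close>

lemma eval_affine_in_var:
  assumes "wf_trm (langE P) t"
  shows "\<exists>c l. term_definable P (fvt t - {x}) l \<and> (\<forall>e a. eval ZZ (e(x := a)) t = c * a + l e)"
  using assms
proof (induction t)
  case (Var y)
  show ?case
  proof (cases "x = y")
    case True
    then show ?thesis using term_definable_const by (intro exI[of _ 1] exI[of _ "\<lambda>_. 0"]) simp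
  next
    case False
    then show ?thesis using term_definable_var[of y] by (intro exI[of _ 0] exI[of _ "\<lambda>e. e y"]) simp
  qed
next
  case (Fun g ts)
  then consider s t where "g = Plus" "ts = [s, t]" | "g = Zero" "ts = []"
    | s where "g = Minus" "ts = [s]" | "g = One" "ts = []"
    by (auto simp: langE_def lang_def length_Suc_conv numeral_2_eq_2)
  then show ?case
  proof cases
    case 1
    then have wf: "wf_trm (langE P) s" "wf_trm (langE P) t" and mem: "s \<in> set ts" "t \<in> set ts"
      using Fun.prems by simp_all
    obtain c l c' l' where "term_definable P (fvt s - {x}) l" "\<forall>e a. eval ZZ (e(x := a)) s = c * a + l e"
      "term_definable P (fvt t - {x}) l'" "\<forall>e a. eval ZZ (e(x := a)) t = c' * a + l' e"
      using Fun.IH[OF mem(1) wf(1)] Fun.IH[OF mem(2) wf(2)] by blast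
    moreover from this have "term_definable P (fvt (Fun g ts) - {x}) (\<lambda>e. l e + l' e)"
      by (intro term_definable_add) (auto simp: 1 intro: term_definable_mono)
    ultimately show ?thesis
      by (intro exI[of _ "c + c'"] exI[of _ "\<lambda>e. l e + l' e"]) (simp add: 1 fint_ZZ algebra_simps del: fun_upd_apply)
  next
    case 2
    then show ?thesis using term_definable_0
      by (intro exI[of _ 0] exI[of _ "\<lambda>_. 0"]) (simp add: fint_ZZ)
  next
    case 3
    then have wf: "wf_trm (langE P) s" and mem: "s \<in> set ts" using Fun.prems by simp_all
    obtain c l where "term_definable P (fvt s - {x}) l" "\<forall>e a. eval ZZ (e(x := a)) s = c * a + l e"
      using Fun.IH[OF mem wf] by blast
    then show ?thesis using term_definable_uminus[of P _ l]
      by (intro exI[of _ "- c"] exI[of _ "\<lambda>e. - l e"]) (simp add: 3 fint_ZZ del: fun_upd_apply)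
  next
    case 4
    then show ?thesis using term_definable_1
      by (intro exI[of _ 0] exI[of _ "\<lambda>_. 1"]) (simp add: fint_ZZ)
  qed
qed

lemma atom_over_mono: "atom_over P V \<alpha> \<Longrightarrow> V \<subseteq> W \<Longrightarrow> atom_over P W \<alpha>"
  unfolding atom_over_def using term_definable_mono by blast

lemma form_of_term:
  assumes "wf_trm (langE P) t"
  obtains f where "term_definable P (fvt t - {x}) (snd f)" "\<forall>e a. eval ZZ (e(x := a)) t = form_val f e a"
proof -
  obtain c l where "term_definable P (fvt t - {x}) l" "\<forall>e a. eval ZZ (e(x := a)) t = c * a + l e"
    using eval_affine_in_var[OF assms] by blast
  then show ?thesis using that[of "(c, l)"] by (simp add: form_val_def)
qed

text \<open>Comparing two independent environments expresses that the formula is one fixed Boolean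
  function of its atoms, without recourse to normal forms.\<close>

lemma quantifier_free_determined_by_atoms:
  assumes "quantifier_free \<phi>" and "wf_fm (langE P) \<phi>"
  shows "\<exists>At. finite At \<and> (\<forall>\<alpha>\<in>At. atom_over P (fv \<phi> - {x}) \<alpha>) \<and>
    (\<forall>e a e' a'. (\<forall>\<alpha>\<in>At. holds e a \<alpha> = holds e' a' \<alpha>) \<longrightarrow>
       sat ZZ (e(x := a)) \<phi> = sat ZZ (e'(x := a')) \<phi>)"
  using assms
proof (induction \<phi>)
  case (Eq s t)
  then have wf: "wf_trm (langE P) s" "wf_trm (langE P) t" by simp_all
  obtain f g where fg: "term_definable P (fvt s - {x}) (snd f)"
    "\<forall>e a. eval ZZ (e(x := a)) s = form_val f e a"
    "term_definable P (fvt t - {x}) (snd g)" "\<forall>e a. eval ZZ (e(x := a)) t = form_val g e a"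
    using form_of_term[OF wf(1), of x] form_of_term[OF wf(2), of x] by metis
  define h where "h = (fst f - fst g, \<lambda>e. snd f e - snd g e)"
  have h: "form_val h e a = 0 \<longleftrightarrow> form_val f e a = form_val g e a" for e a
    by (auto simp: h_def form_val_def algebra_simps)
  have "term_definable P (fv (Eq s t) - {x}) (snd h)"
    unfolding h_def snd_conv
    by (intro term_definable_diff term_definable_mono[OF fg(1)] term_definable_mono[OF fg(3)]) auto
  then show ?case by (intro exI[of _ "{ZeroA h}"]) (simp add: fg h atom_over_def del: fun_upd_apply)
next
  case (Rel r ts)
  then consider p s t where "p \<in> P" "r = VDvd p" "ts = [s, t]" | n t where "n \<ge> 1" "r = D n" "ts = [t]"
    by (auto simp: langE_def lang_def length_Suc_conv numeral_2_eq_2)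
  then show ?case
  proof cases
    case 1
    then have wf: "wf_trm (langE P) s" "wf_trm (langE P) t" using Rel.prems by simp_all
    obtain f g where fg: "term_definable P (fvt s - {x}) (snd f)"
      "\<forall>e a. eval ZZ (e(x := a)) s = form_val f e a"
      "term_definable P (fvt t - {x}) (snd g)" "\<forall>e a. eval ZZ (e(x := a)) t = form_val g e a"
      using form_of_term[OF wf(1), of x] form_of_term[OF wf(2), of x] by metis
    have "atom_over P (fv (Rel r ts) - {x}) (ValA p f g)"
      using 1 by (auto simp: atom_over_def intro: term_definable_mono[OF fg(1)] term_definable_mono[OF fg(3)])
    then show ?thesis by (intro exI[of _ "{ValA p f g}"]) (simp add: 1 fg rint_ZZ del: fun_upd_apply)
  next
    case 2
    then have wf: "wf_trm (langE P) t" using Rel.prems by simp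
    obtain f where f: "term_definable P (fvt t - {x}) (snd f)"
      "\<forall>e a. eval ZZ (e(x := a)) t = form_val f e a"
      by (rule form_of_term[OF wf])
    show ?thesis using 2 f
      by (intro exI[of _ "{DivA n f}"]) (simp add: atom_over_def rint_ZZ rel_int_D del: rel_int.simps(2) fun_upd_apply)
  qed
next
  case (Neg \<phi>)
  then show ?case by auto
next
  case (And \<phi> \<psi>)
  then have prems: "quantifier_free \<phi>" "wf_fm (langE P) \<phi>" "quantifier_free \<psi>" "wf_fm (langE P) \<psi>"
    by simp_all
  from And.IH(1)[OF prems(1,2)] obtain A where A: "finite A" "\<forall>\<alpha>\<in>A. atom_over P (fv \<phi> - {x}) \<alpha>"
    "\<forall>e a e' a'. (\<forall>\<alpha>\<in>A. holds e a \<alpha> = holds e' a' \<alpha>) \<longrightarrow> sat ZZ (e(x := a)) \<phi> = sat ZZ (e'(x := a')) \<phi>"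
    by (elim exE conjE)
  from And.IH(2)[OF prems(3,4)] obtain B where B: "finite B" "\<forall>\<alpha>\<in>B. atom_over P (fv \<psi> - {x}) \<alpha>"
    "\<forall>e a e' a'. (\<forall>\<alpha>\<in>B. holds e a \<alpha> = holds e' a' \<alpha>) \<longrightarrow> sat ZZ (e(x := a)) \<psi> = sat ZZ (e'(x := a')) \<psi>"
    by (elim exE conjE)
  show ?case
  proof (intro exI[of _ "A \<union> B"] conjI allI impI)
    show "finite (A \<union> B)" using A(1) B(1) by simp
    show "\<forall>\<alpha>\<in>A \<union> B. atom_over P (fv (And \<phi> \<psi>) - {x}) \<alpha>"
      using A(2) B(2) by (auto intro: atom_over_mono)
    fix e a e' a'
    assume *: "\<forall>\<alpha>\<in>A \<union> B. holds e a \<alpha> = holds e' a' \<alpha>"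
    have "sat ZZ (e(x := a)) \<phi> = sat ZZ (e'(x := a')) \<phi>" using A(3) * by blast
    moreover have "sat ZZ (e(x := a)) \<psi> = sat ZZ (e'(x := a')) \<psi>" using B(3) * by blast
    ultimately show "sat ZZ (e(x := a)) (And \<phi> \<psi>) = sat ZZ (e'(x := a')) (And \<phi> \<psi>)"
      by (simp only: sat.simps)
  qed
next
  case (Exists y \<phi>)
  then show ?case by simp
qed

text \<open>Whether \<open>S\<close> holds at \<open>e(x := a)\<close> depends only on the set of
  atoms true there. So \<open>\<exists>a\<close> becomes a finite disjunction over such sets, and
  \<open>atom_type_solvability_definable\<close> treats each of them.\<close>

lemma qf_definable_Ex:
  assumes P: "P \<noteq> {}" "\<forall>p\<in>P. prime p" and S: "qf_definable P V S"
  shows "qf_definable P (V - {x}) (\<lambda>e. \<exists>a. S (e(x := a)))"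
proof -
  from S obtain \<psi> where \<psi>: "wf_fm (langE P) \<psi>" "quantifier_free \<psi>" "fv \<psi> \<subseteq> V" "\<forall>e. sat ZZ e \<psi> = S e"
    unfolding qf_definable_def by blast
  from quantifier_free_determined_by_atoms[OF \<psi>(2,1), of x]
  obtain At where At: "finite At" "\<forall>\<alpha>\<in>At. atom_over P (fv \<psi> - {x}) \<alpha>"
    and "\<forall>e a e' a'. (\<forall>\<alpha>\<in>At. holds e a \<alpha> = holds e' a' \<alpha>) \<longrightarrow>
      sat ZZ (e(x := a)) \<psi> = sat ZZ (e'(x := a')) \<psi>"
    by (elim exE conjE)
  then have det: "S (e(x := a)) = S (e'(x := a'))" if "\<forall>\<alpha>\<in>At. holds e a \<alpha> = holds e' a' \<alpha>" for e a e' a'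
    using that unfolding \<psi>(4)[rule_format] by blast
  define type where "type e a = {\<alpha>\<in>At. holds e a \<alpha>}" for e a
  \<comment> \<open>The environment is quantified here, so \<open>good\<close> does not depend on
    \<open>e\<close>; by \<open>det\<close>, a type taken from another environment still guarantees
    \<open>S\<close> at \<open>e\<close>.\<close>
  define good where "good = {type e a | e a. S (e(x := a))}"
  have type: "type e a = \<tau> \<longleftrightarrow> (\<forall>\<alpha>\<in>At. holds e a \<alpha> = (\<alpha> \<in> \<tau>))" if "\<tau> \<in> good" for e a \<tau>
    using that by (auto simp: good_def type_def)
  have "good \<subseteq> Pow At" by (auto simp: good_def type_def)
  then have fin: "finite good" using At(1) by (simp add: finite_subset)
  have "(\<exists>a. S (e(x := a))) \<longleftrightarrow> (\<exists>\<tau>\<in>good. \<exists>a. \<forall>\<alpha>\<in>At. holds e a \<alpha> = (\<alpha> \<in> \<tau>))" for e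
  proof
    assume "\<exists>a. S (e(x := a))"
    then obtain a where "S (e(x := a))" by blast
    then have "type e a \<in> good" unfolding good_def by blast
    then show "\<exists>\<tau>\<in>good. \<exists>a. \<forall>\<alpha>\<in>At. holds e a \<alpha> = (\<alpha> \<in> \<tau>)"
      by (intro bexI[of _ "type e a"] exI[of _ a] type[THEN iffD1, OF _ refl])
  next
    assume "\<exists>\<tau>\<in>good. \<exists>a. \<forall>\<alpha>\<in>At. holds e a \<alpha> = (\<alpha> \<in> \<tau>)"
    then obtain \<tau> a where \<tau>: "\<tau> \<in> good" "\<forall>\<alpha>\<in>At. holds e a \<alpha> = (\<alpha> \<in> \<tau>)" by blast
    from \<tau>(1) obtain e' a' where e': "\<tau> = type e' a'" "S (e'(x := a'))" unfolding good_def by blast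
    have "\<forall>\<alpha>\<in>At. holds e a \<alpha> = holds e' a' \<alpha>" using \<tau>(2) by (simp add: e'(1) type_def)
    from det[OF this] e'(2) show "\<exists>a. S (e(x := a))" by blast
  qed
  moreover have "qf_definable P (fv \<psi> - {x}) (\<lambda>e. \<exists>\<tau>\<in>good. \<exists>a. \<forall>\<alpha>\<in>At. holds e a \<alpha> = (\<alpha> \<in> \<tau>))"
    using At by (intro qf_definable_bex fin atom_type_solvability_definable P) auto
  ultimately have "qf_definable P (fv \<psi> - {x}) (\<lambda>e. \<exists>a. S (e(x := a)))" by simp
  then show ?thesis by (rule qf_definable_mono) (use \<psi>(3) in auto)
qed

lemma qf_definable_sat:
  assumes P: "P \<noteq> {}" "\<forall>p\<in>P. prime p" and "wf_fm (langE P) \<phi>"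
  shows "qf_definable P (fv \<phi>) (\<lambda>e. sat ZZ e \<phi>)"
  using assms(3)
proof (induction \<phi>)
  case (Eq s t)
  then show ?case unfolding qf_definable_def by (intro exI[of _ "Eq s t"]) simp
next
  case (Rel r ts)
  then show ?case unfolding qf_definable_def by (intro exI[of _ "Rel r ts"]) simp
next
  case (Neg \<phi>)
  then show ?case using qf_definable_not by simp
next
  case (And \<phi> \<psi>)
  then show ?case using qf_definable_mono[of P "fv \<phi>" _ "fv \<phi> \<union> fv \<psi>"] qf_definable_mono[of P "fv \<psi>" _ "fv \<phi> \<union> fv \<psi>"]
    by (auto intro!: qf_definable_conj)
next
  case (Exists x \<phi>)
  then show ?case using qf_definable_Ex[OF P, of "fv \<phi>" "\<lambda>e. sat ZZ e \<phi>" x] by (simp add: ZZ_def)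
qed

theorem theorem1p1:
  fixes P :: "nat set"
  assumes "P \<noteq> {}" and "\<forall>p\<in>P. prime p"
  shows "eliminates_quantifiers TYPE('m) (langE P) (TPE P)"
  unfolding eliminates_quantifiers_def TPE_def
proof (intro allI impI)
  fix \<phi> :: "(fsym, rsym) fm"
  assume \<phi>: "wf_fm (langE P) \<phi>"
  then obtain \<psi> where \<psi>: "wf_fm (langE P) \<psi>" "quantifier_free \<psi>" "fv \<psi> \<subseteq> fv \<phi>"
    "\<forall>e. sat ZZ e \<psi> = sat ZZ e \<phi>"
    using qf_definable_sat[OF assms] unfolding qf_definable_def by blast
  have "valid ZZ (Iff \<phi> \<psi>)" using \<psi>(4) by (simp add: valid_def Iff_def Imp_def Or_def)
  moreover have "wf_fm (langE P) (Iff \<phi> \<psi>)" using \<phi> \<psi>(1) by (simp add: Iff_def Imp_def Or_def)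
  \<comment> \<open>The equivalent was found over the integers alone and is independent of
    \<open>'m\<close>; it passes to all models because the theory is that of
    \<open>ZZ\<close>.\<close>
  ultimately have "entails TYPE('m) (langE P) (Th (langE P) ZZ) (Iff \<phi> \<psi>)"
    by (intro entails_Th(2) is_structure_ZZ)
  with \<psi> show "\<exists>\<psi>. wf_fm (langE P) \<psi> \<and> quantifier_free \<psi> \<and> fv \<psi> \<subseteq> fv \<phi> \<and>
      entails TYPE('m) (langE P) (Th (langE P) ZZ) (Iff \<phi> \<psi>)" by blast
qed

end
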